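(* Every three-dimensional unimodular real Lie algebra $\mathfrak g$ admits a generalized Einstein structure $(H,g,\delta)$ with non-zero divergence, $\delta\neq0$, as well as a divergence-free generalized Einstein structure $(H',g',0)$.
   Context: A Lie algebra is unimodular if $\mathrm{tr}\,\mathrm{ad}_X=0$ for all $X$. Let $E=\mathfrak g\oplus\mathfrak g^*$, with scalar product $\langle X+\xi,Y+\eta\rangle=\frac12(\xi(Y)+\eta(X))$. For $H\in\bigwedge^3\mathfrak g^*$ (automatically closed when $\dim\mathfrak g=3$) the Dorfman bracket is $[X+\xi,Y+\eta]_H=[X,Y]-\mathrm{ad}_X^*\eta+\mathrm{ad}_Y^*\xi+H(X,Y,\cdot)$, where $\mathrm{ad}_X^*\eta=\eta\circ\mathrm{ad}_X$. For a non-degenerate symmetric bilinear form $g$ on $\mathfrak g$ put $gX=g(X,\cdot)$ and $E_\pm=\{X\pm gX:X\in\mathfrak g\}$. A left-invariant generalized connection is a linear map $D:E\to\mathfrak{so}(E)$, $u\mapsto D_u$. Its torsion is $T(u,v)=D_uv-D_vu-[u,v]_H+(Du)^*v$, where $Du$ is $w\mapsto D_wu$ and $*$ is the adjoint for $\langle\cdot,\cdot\rangle$. $D$ is Levi-Civita if $T=0$ and $D_uE_\pm\subset E_\pm$ for all $u$. Its divergence is $\delta_D(v)=\mathrm{tr}(u\mapsto D_uv)$. Given $\delta\in E^*$, choose a Levi-Civita $D$ with $\delta_D=\delta$ (one exists), put $R(u,v)w=D_uD_vw-D_vD_uw-D_{[u,v]_H}w$ and, for $u_\pm\in E_\pm$,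 $Ric^+_\delta(u_-,u_+)=\mathrm{tr}(E_+\ni w\mapsto R(w,u_-)u_+\in E_+)$, $Ric^-_\delta(u_+,u_-)=\mathrm{tr}(E_-\ni w\mapsto R(w,u_+)u_-\in E_-)$; these are known to be independent of the choice of $D$. A generalized Einstein structure on $\mathfrak g$ is a triple $(H,g,\delta)$ with $H\in\bigwedge^3\mathfrak g^*$, $g\in\mathrm{Sym}^2\mathfrak g^*$ non-degenerate and $\delta\in E^*$ such that $Ric^+_\delta=0$ and $Ric^-_\delta=0$. It is divergence-free if $\delta=0$. *)

theory Defs
  imports "HOL-Analysis.Analysis"
begin

section \<open>Dual space and trace\<close>

typedef (overloaded) 'a dual_space = "{f :: 'a::real_vector \<Rightarrow> real. linear f}"
  morphisms dual_apply Dual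
  by (rule exI[of _ "\<lambda>_. 0"]) (simp add: linear_iff)

setup_lifting type_definition_dual_space

instantiation dual_space :: (real_vector) real_vector
begin

lift_definition zero_dual_space :: "'a dual_space" is "\<lambda>_. 0"
  by (simp add: linear_iff)

lift_definition plus_dual_space :: "'a dual_space \<Rightarrow> 'a dual_space \<Rightarrow> 'a dual_space"
  is "\<lambda>f g x. f x + g x"
  by (simp add: linear_iff algebra_simps)

lift_definition uminus_dual_space :: "'a dual_space \<Rightarrow> 'a dual_space"
  is "\<lambda>f x. - f x"
  by (simp add: linear_iff)

lift_definition minus_dual_space :: "'a dual_space \<Rightarrow> 'a dual_space \<Rightarrow> 'a dual_space"
  is "\<lambda>f g x. f x - g x"
  by (simp add: linear_iff algebra_simps)

lift_definition scaleR_dual_space :: "real \<Rightarrow> 'a dual_space \<Rightarrow> 'a dual_space"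
  is "\<lambda>c f x. c * f x"
  by (simp add: linear_iff algebra_simps)

instance
  by standard (transfer; simp add: fun_eq_iff algebra_simps)+

end

text \<open>Trace of a linear endomorphism of a finite-dimensional subspace \<open>V\<close>: the sum of the
  diagonal matrix entries with respect to some basis of \<open>V\<close>.  Only the values of \<open>f\<close> on \<open>V\<close>
  matter, and \<open>f\<close> is supposed to map \<open>V\<close> into itself.\<close>

definition trace_on :: "'a::real_vector set \<Rightarrow> ('a \<Rightarrow> 'a) \<Rightarrow> real" where
  "trace_on V f =
     (let B = (SOME B. independent B \<and> span B = V) in \<Sum>b\<in>B. representation B (f b) b)"


section \<open>Lie algebras\<close>

definition lie_algebra :: "('a::real_vector \<Rightarrow> 'a \<Rightarrow> 'a) \<Rightarrow> bool" where
  "lie_algebra br \<longleftrightarrow>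
     bilinear br \<and> (\<forall>x. br x x = 0) \<and>
     (\<forall>x y z. br x (br y z) + br y (br z x) + br z (br x y) = 0)"

definition unimodular :: "('a::real_vector \<Rightarrow> 'a \<Rightarrow> 'a) \<Rightarrow> bool" where
  "unimodular br \<longleftrightarrow> (\<forall>x. trace_on UNIV (br x) = 0)"


section \<open>The generalized tangent space\<close>

definition three_form :: "('a::real_vector \<Rightarrow> 'a \<Rightarrow> 'a \<Rightarrow> real) \<Rightarrow> bool" where
  "three_form H \<longleftrightarrow>
     (\<forall>y z. linear (\<lambda>x. H x y z)) \<and> (\<forall>x z. linear (\<lambda>y. H x y z)) \<and> (\<forall>x y. linear (\<lambda>z. H x y z)) \<and>
     (\<forall>x y. H x x y = 0 \<and> H x y x = 0 \<and> H y x x = 0)"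

definition nondegenerate_metric :: "('a::real_vector \<Rightarrow> 'a \<Rightarrow> real) \<Rightarrow> bool" where
  "nondegenerate_metric g \<longleftrightarrow>
     bilinear g \<and> (\<forall>x y. g x y = g y x) \<and> (\<forall>x. (\<forall>y. g x y = 0) \<longrightarrow> x = 0)"

type_synonym 'a gen = "'a \<times> 'a dual_space"

definition pairing :: "'a::real_vector gen \<Rightarrow> 'a gen \<Rightarrow> real" where
  "pairing u v = (dual_apply (snd u) (fst v) + dual_apply (snd v) (fst u)) / 2"

definition pairing_adjoint :: "('a::real_vector gen \<Rightarrow> 'a gen) \<Rightarrow> 'a gen \<Rightarrow> 'a gen" where
  "pairing_adjoint f = (THE f'. \<forall>v w. pairing (f v) w = pairing v (f' w))"

definition coad :: "('a::real_vector \<Rightarrow> 'a \<Rightarrow> 'a) \<Rightarrow> 'a \<Rightarrow> 'a dual_space \<Rightarrow> 'a dual_space" where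
  "coad br x \<eta> = Dual (\<lambda>y. dual_apply \<eta> (br x y))"

definition dorfman ::
  "('a::real_vector \<Rightarrow> 'a \<Rightarrow> 'a) \<Rightarrow> ('a \<Rightarrow> 'a \<Rightarrow> 'a \<Rightarrow> real) \<Rightarrow> 'a gen \<Rightarrow> 'a gen \<Rightarrow> 'a gen" where
  "dorfman br H u v =
     (br (fst u) (fst v),
      - coad br (fst u) (snd v) + coad br (fst v) (snd u) + Dual (H (fst u) (fst v)))"

definition E_plus :: "('a::real_vector \<Rightarrow> 'a \<Rightarrow> real) \<Rightarrow> 'a gen set" where
  "E_plus g = {(x, Dual (g x)) | x. True}"

definition E_minus :: "('a::real_vector \<Rightarrow> 'a \<Rightarrow> real) \<Rightarrow> 'a gen set" where
  "E_minus g = {(x, - Dual (g x)) | x. True}"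


section \<open>Generalized connections\<close>

definition generalized_connection :: "('a::real_vector gen \<Rightarrow> 'a gen \<Rightarrow> 'a gen) \<Rightarrow> bool" where
  "generalized_connection D \<longleftrightarrow>
     bilinear D \<and> (\<forall>u v w. pairing (D u v) w + pairing v (D u w) = 0)"

definition torsion ::
  "('a::real_vector \<Rightarrow> 'a \<Rightarrow> 'a) \<Rightarrow> ('a \<Rightarrow> 'a \<Rightarrow> 'a \<Rightarrow> real) \<Rightarrow> ('a gen \<Rightarrow> 'a gen \<Rightarrow> 'a gen) \<Rightarrow>
    'a gen \<Rightarrow> 'a gen \<Rightarrow> 'a gen" where
  "torsion br H D u v =
     D u v - D v u - dorfman br H u v + pairing_adjoint (\<lambda>w. D w u) v"

definition levi_civita ::
  "('a::real_vector \<Rightarrow> 'a \<Rightarrow> 'a) \<Rightarrow> ('a \<Rightarrow> 'a \<Rightarrow> 'a \<Rightarrow> real) \<Rightarrow> ('a \<Rightarrow> 'a \<Rightarrow> real) \<Rightarrow>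
    ('a gen \<Rightarrow> 'a gen \<Rightarrow> 'a gen) \<Rightarrow> bool" where
  "levi_civita br H g D \<longleftrightarrow>
     generalized_connection D \<and> (\<forall>u v. torsion br H D u v = 0) \<and>
     (\<forall>u. D u ` E_plus g \<subseteq> E_plus g \<and> D u ` E_minus g \<subseteq> E_minus g)"

definition divergence :: "('a::real_vector gen \<Rightarrow> 'a gen \<Rightarrow> 'a gen) \<Rightarrow> 'a gen dual_space" where
  "divergence D = Dual (\<lambda>v. trace_on UNIV (\<lambda>u. D u v))"

definition curvature ::
  "('a::real_vector \<Rightarrow> 'a \<Rightarrow> 'a) \<Rightarrow> ('a \<Rightarrow> 'a \<Rightarrow> 'a \<Rightarrow> real) \<Rightarrow> ('a gen \<Rightarrow> 'a gen \<Rightarrow> 'a gen) \<Rightarrow>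
    'a gen \<Rightarrow> 'a gen \<Rightarrow> 'a gen \<Rightarrow> 'a gen" where
  "curvature br H D u v w = D u (D v w) - D v (D u w) - D (dorfman br H u v) w"

text \<open>When the Lie algebra has dimension at least 2, a Levi-Civita connection with divergence
  \<open>\<delta>\<close> exists for every \<open>\<delta>\<close>, and the two Ricci tensors below do not depend on the choice.\<close>

definition levi_civita_choice ::
  "('a::real_vector \<Rightarrow> 'a \<Rightarrow> 'a) \<Rightarrow> ('a \<Rightarrow> 'a \<Rightarrow> 'a \<Rightarrow> real) \<Rightarrow> ('a \<Rightarrow> 'a \<Rightarrow> real) \<Rightarrow>
    'a gen dual_space \<Rightarrow> 'a gen \<Rightarrow> 'a gen \<Rightarrow> 'a gen" where
  "levi_civita_choice br H g \<delta> = (SOME D. levi_civita br H g D \<and> divergence D = \<delta>)"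

definition ricci_plus ::
  "('a::real_vector \<Rightarrow> 'a \<Rightarrow> 'a) \<Rightarrow> ('a \<Rightarrow> 'a \<Rightarrow> 'a \<Rightarrow> real) \<Rightarrow> ('a \<Rightarrow> 'a \<Rightarrow> real) \<Rightarrow>
    'a gen dual_space \<Rightarrow> 'a gen \<Rightarrow> 'a gen \<Rightarrow> real" where
  "ricci_plus br H g \<delta> u v =
     trace_on (E_plus g) (\<lambda>w. curvature br H (levi_civita_choice br H g \<delta>) w u v)"

definition ricci_minus ::
  "('a::real_vector \<Rightarrow> 'a \<Rightarrow> 'a) \<Rightarrow> ('a \<Rightarrow> 'a \<Rightarrow> 'a \<Rightarrow> real) \<Rightarrow> ('a \<Rightarrow> 'a \<Rightarrow> real) \<Rightarrow>
    'a gen dual_space \<Rightarrow> 'a gen \<Rightarrow> 'a gen \<Rightarrow> real" where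
  "ricci_minus br H g \<delta> u v =
     trace_on (E_minus g) (\<lambda>w. curvature br H (levi_civita_choice br H g \<delta>) w u v)"

definition generalized_einstein ::
  "('a::real_vector \<Rightarrow> 'a \<Rightarrow> 'a) \<Rightarrow> ('a \<Rightarrow> 'a \<Rightarrow> 'a \<Rightarrow> real) \<Rightarrow> ('a \<Rightarrow> 'a \<Rightarrow> real) \<Rightarrow>
    'a gen dual_space \<Rightarrow> bool" where
  "generalized_einstein br H g \<delta> \<longleftrightarrow>
     three_form H \<and> nondegenerate_metric g \<and>
     (\<forall>u\<in>E_minus g. \<forall>v\<in>E_plus g. ricci_plus br H g \<delta> u v = 0) \<and>
     (\<forall>u\<in>E_plus g. \<forall>v\<in>E_minus g. ricci_minus br H g \<delta> u v = 0)"

end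

theory Submission imports Defs begin

text \<open>Put \<open>P = \<nabla> + H/2\<close> and \<open>M = \<nabla> - H/2\<close>, with \<open>\<nabla>\<close> the Levi-Civita connection of \<open>g\<close>.  The
  mixed Dorfman brackets are \<open>[x\<^sub>-, y\<^sub>+]\<^sub>+ = (P x y)\<^sub>+\<close> and \<open>[x\<^sub>+, y\<^sub>-]\<^sub>- = (M x y)\<^sub>-\<close>.  For every
  generalized Levi-Civita connection with divergence \<open>\<delta>\<close>, vanishing torsion and cyclicity of the
  trace give
  \<open>Ric\<^sup>+(x\<^sub>-, y\<^sub>+) = \<delta>((P x y)\<^sub>+) - tr (w \<mapsto> P (M w x) y)\<close>, and symmetrically for \<open>Ric\<^sup>-\<close>.  So
  \<open>(H, g, \<delta>)\<close> is Einstein as soon as \<open>P (M x y) z = 0 = M (P x y) z\<close> and \<open>\<delta>\<close> kills all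
  \<open>(P x y)\<^sub>+\<close> and \<open>(M x y)\<^sub>-\<close>.

  Unimodularity means that in a basis \<open>[x, y] = L (x \<times> y)\<close> with \<open>L\<close> a symmetric matrix.
  If \<open>det L \<noteq> 0\<close>, the adjugate of \<open>L\<close> is an invariant metric \<open>g\<close>; with \<open>H x y z = g [x, y] z\<close> one
  gets \<open>M = 0\<close>, and \<open>\<delta>\<close> may be any functional vanishing on \<open>E\<^sub>+\<close>.
  If \<open>det L = 0\<close>, a linear form \<open>\<alpha> \<noteq> 0\<close> vanishes on all brackets, and with \<open>H = 0\<close> and a suitable
  flat metric \<open>P x y = M x y = \<alpha> x B y\<close> where \<open>\<alpha> \<circ> B = 0\<close>, so \<open>\<delta> = \<alpha> \<circ> fst\<close> works.\<close>

section \<open>Traces on finite-dimensional subspaces\<close>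

text \<open>\<open>trace_on\<close> picks its basis by \<open>SOME\<close>, depending on
  \<open>V\<close> alone. One \<open>B\<close> therefore serves all \<open>f\<close>, and trace
  identities can be checked on diagonal entries.\<close>

lemma trace_on_obtain_basis:
  assumes "subspace V"
  obtains B where "independent B" "span B = V"
    "\<And>f. trace_on V f = (\<Sum>b\<in>B. representation B (f b) b)"
proof -
  obtain B where "B \<subseteq> V" "independent B" "V \<subseteq> span B"
    using real_vector.maximal_independent_subset by blast
  then have "\<exists>B. independent B \<and> span B = V"
    using assms by (metis span_minimal subset_antisym)
  note SB = someI_ex[OF this]
  show ?thesis
    by (rule that[OF conjunct1[OF SB] conjunct2[OF SB]]) (simp only: trace_on_def Let_def)
qed

lemma finite_independent_in_span:
  assumes "finite S" "V \<subseteq> span S" "independent B" "span B = V"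
  shows "finite B"
  using assms real_vector.independent_span_bound span_superset by blast

lemma representation_linear_image:
  assumes "independent B" "finite B" "independent C" "finite C" "linear f"
    "f ` span B \<subseteq> span C" "x \<in> span B"
  shows "representation C (f x) c = (\<Sum>b\<in>B. representation B x b * representation C (f b) c)"
proof -
  have "f x = (\<Sum>b\<in>B. representation B x b *\<^sub>R f b)"
    using assms by (subst (1) real_vector.sum_representation_eq[symmetric, of B x B])
      (auto simp: linear_sum linear_scale)
  moreover have "f b \<in> span C" if "b \<in> B" for b
    using that assms(6) by (auto intro: span_base)
  ultimately show ?thesis
    using assms by (simp add: real_vector.representation_sum real_vector.representation_scale
        span_scale)
qed

text \<open>Both sides are the double sum of products of matrix entries of \<open>f\<close> and
  \<open>h\<close>, taken in opposite orders.\<close>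

lemma sum_representation_commute:
  assumes "independent B" "finite B" "independent C" "finite C" "linear f" "linear h"
    "f ` span C \<subseteq> span B" "h ` span B \<subseteq> span C"
  shows "(\<Sum>b\<in>B. representation B (f (h b)) b) = (\<Sum>c\<in>C. representation C (h (f c)) c)"
proof -
  have hB: "h b \<in> span C" if "b \<in> B" for b
    using assms(8) that by (auto simp: span_base)
  have fC: "f c \<in> span B" if "c \<in> C" for c
    using assms(7) that by (auto simp: span_base)
  have "(\<Sum>b\<in>B. representation B (f (h b)) b)
      = (\<Sum>b\<in>B. \<Sum>c\<in>C. representation C (h b) c * representation B (f c) b)"
    using assms hB by (intro sum.cong refl representation_linear_image) auto
  also have "\<dots> = (\<Sum>c\<in>C. \<Sum>b\<in>B. representation B (f c) b * representation C (h b) c)"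
    by (subst sum.swap) (simp add: mult.commute)
  also have "\<dots> = (\<Sum>c\<in>C. representation C (h (f c)) c)"
    using assms fC by (intro sum.cong refl representation_linear_image[symmetric]) auto
  finally show ?thesis .
qed

text \<open>The two spaces may differ. Besides cyclicity this yields, with an inclusion as
  \<open>f\<close>, the restriction of a trace to a subspace containing the image. \<open>S\<close>
  and \<open>T\<close> witness finite dimension.\<close>

lemma trace_on_commute:
  assumes "subspace V" "finite S" "V \<subseteq> span S" "subspace W" "finite T" "W \<subseteq> span T"
    "linear f" "linear h" "f ` W \<subseteq> V" "h ` V \<subseteq> W"
  shows "trace_on V (\<lambda>x. f (h x)) = trace_on W (\<lambda>x. h (f x))"
proof -
  obtain B where B: "independent B" "span B = V"
    "\<And>f. trace_on V f = (\<Sum>b\<in>B. representation B (f b) b)"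
    using trace_on_obtain_basis[OF assms(1)] by blast
  obtain C where C: "independent C" "span C = W"
    "\<And>f. trace_on W f = (\<Sum>b\<in>C. representation C (f b) b)"
    using trace_on_obtain_basis[OF assms(4)] by blast
  have "finite B" "finite C"
    using finite_independent_in_span[OF assms(2,3) B(1,2)]
      finite_independent_in_span[OF assms(5,6) C(1,2)] by auto
  then show ?thesis
    unfolding B(3) C(3)
    using B(1,2) C(1,2) assms(7-10) by (intro sum_representation_commute) auto
qed

lemma trace_on_cong:
  assumes "subspace V" "\<And>x. x \<in> V \<Longrightarrow> f x = h x"
  shows "trace_on V f = trace_on V h"
proof -
  obtain B where B: "span B = V"
    "\<And>f. trace_on V f = (\<Sum>b\<in>B. representation B (f b) b)"
    using trace_on_obtain_basis[OF assms(1)] by blast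
  then have "b \<in> V" if "b \<in> B" for b
    using that span_base by blast
  then show ?thesis
    unfolding B(2) using assms(2) by simp
qed

lemma trace_on_add:
  assumes "subspace V" "f ` V \<subseteq> V" "h ` V \<subseteq> V"
  shows "trace_on V (\<lambda>x. f x + h x) = trace_on V f + trace_on V h"
proof -
  obtain B where B: "independent B" "span B = V"
    "\<And>f. trace_on V f = (\<Sum>b\<in>B. representation B (f b) b)"
    using trace_on_obtain_basis[OF assms(1)] by blast
  then have "f b \<in> span B" "h b \<in> span B" if "b \<in> B" for b
    using that assms(2,3) span_base by blast+
  then show ?thesis
    unfolding B(3) using B(1) by (simp add: real_vector.representation_add sum.distrib)
qed

lemma trace_on_scaleR:
  assumes "subspace V" "f ` V \<subseteq> V"
  shows "trace_on V (\<lambda>x. c *\<^sub>R f x) = c * trace_on V f"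
proof -
  obtain B where B: "independent B" "span B = V"
    "\<And>f. trace_on V f = (\<Sum>b\<in>B. representation B (f b) b)"
    using trace_on_obtain_basis[OF assms(1)] by blast
  then have "f b \<in> span B" if "b \<in> B" for b
    using that assms(2) span_base by blast+
  then show ?thesis
    unfolding B(3) using B(1) by (simp add: real_vector.representation_scale sum_distrib_left)
qed

lemma trace_on_diff:
  assumes "subspace V" "f ` V \<subseteq> V" "h ` V \<subseteq> V"
  shows "trace_on V (\<lambda>x. f x - h x) = trace_on V f - trace_on V h"
proof -
  have "(\<lambda>x. (-1) *\<^sub>R h x) ` V \<subseteq> V"
    using assms(1,3) by (auto simp: subspace_neg)
  from trace_on_add[OF assms(1,2) this] show ?thesis
    by (simp only: trace_on_scaleR[OF assms(1,3)]) simp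
qed

lemma trace_on_rank_one:
  assumes "subspace V" "finite S" "V \<subseteq> span S" "linear l" "x \<in> V"
  shows "trace_on V (\<lambda>y. l y *\<^sub>R x) = l x"
proof -
  obtain B where B: "independent B" "span B = V"
    "\<And>f. trace_on V f = (\<Sum>b\<in>B. representation B (f b) b)"
    using trace_on_obtain_basis[OF assms(1)] by blast
  have "finite B" by (rule finite_independent_in_span[OF assms(2,3) B(1,2)])
  then have "x = (\<Sum>b\<in>B. representation B x b *\<^sub>R b)"
    using B(1,2) assms(5) by (subst real_vector.sum_representation_eq) auto
  then have "l x = (\<Sum>b\<in>B. l b * representation B x b)"
    using linear_sum[OF assms(4), of "\<lambda>b. representation B x b *\<^sub>R b" B]
    by (simp add: linear_scale[OF assms(4)] mult.commute)
  then show ?thesis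
    unfolding B(3) using B(1,2) assms(5) by (simp add: real_vector.representation_scale)
qed

lemma trace_on_ident:
  assumes "subspace V"
  shows "trace_on V (\<lambda>x. x) = dim V"
proof -
  obtain B where B: "independent B" "span B = V"
    "\<And>f. trace_on V f = (\<Sum>b\<in>B. representation B (f b) b)"
    using trace_on_obtain_basis[OF assms(1)] by blast
  have "(\<Sum>b\<in>B. representation B b b) = (\<Sum>b\<in>B. 1)"
    using B(1) by (intro sum.cong refl) (simp add: real_vector.representation_basis)
  moreover have "dim V = card B"
    using B(1,2) real_vector.dim_span_eq_card_independent by metis
  ultimately show ?thesis unfolding B(3) by simp
qed

lemma linear_inj_imp_surj_fin:
  fixes f :: "'a::real_vector \<Rightarrow> 'a"
  assumes "finite S" "span S = (UNIV :: 'a set)" "linear f" "inj f"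
  shows "surj f"
proof -
  obtain B where B: "B \<subseteq> S" "independent B" "S \<subseteq> span B"
    using real_vector.maximal_independent_subset by blast
  then have sp: "span B = UNIV"
    using assms(2) by (metis span_minimal subspace_span top.extremum_uniqueI)
  interpret F: finite_dimensional_vector_space "(*\<^sub>R) :: real \<Rightarrow> 'a \<Rightarrow> 'a" B
    using B sp assms(1)
    by unfold_locales (auto simp: finite_subset dependent_raw_def span_raw_def)
  show ?thesis using F.linear_inj_imp_surj[of f] assms by (simp add: linear_def)
qed

section \<open>The splitting of the generalized tangent space by a metric\<close>

lemma dual_apply_Dual: "linear f \<Longrightarrow> dual_apply (Dual f) = f"
  by (simp add: Dual_inverse)

lemma linear_dual_apply: "linear (dual_apply \<xi>)"
  using dual_apply by blast

lemma dual_eqI: "(\<And>x. dual_apply \<xi> x = dual_apply \<eta> x) \<Longrightarrow> \<xi> = \<eta>"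
  by (metis dual_apply_inverse ext)

lemmas dual_apply_simps = zero_dual_space.rep_eq plus_dual_space.rep_eq uminus_dual_space.rep_eq
  minus_dual_space.rep_eq scaleR_dual_space.rep_eq

lemmas linear_rules = linear_add linear_diff linear_scale linear_neg linear_0

lemmas bilinear_rules = bilinear_ladd bilinear_radd bilinear_lmul bilinear_rmul bilinear_lneg
  bilinear_rneg bilinear_lsub bilinear_rsub bilinear_lzero bilinear_rzero

text \<open>An infinite basis would have \<open>card\<close> 0, so positive \<open>dim\<close>
  forces finiteness.\<close>

lemma finite_basis_exists:
  assumes "dim (UNIV :: 'a::real_vector set) > 0"
  obtains B :: "'a::real_vector set" where "finite B" "independent B" "span B = UNIV"
      "card B = dim (UNIV :: 'a::real_vector set)"
proof -
  obtain B :: "'a set" where B: "independent B" "span B = UNIV"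
    using real_vector.maximal_independent_subset[of UNIV] by (metis top.extremum_uniqueI)
  then have "card B = dim (UNIV :: 'a::real_vector set)"
    using real_vector.dim_span_eq_card_independent by metis
  moreover from this assms have "finite B"
    by (metis card.infinite less_irrefl)
  ultimately show ?thesis using B that by blast
qed

text \<open>Dimension n at least 2 yields a finite basis and, later, makes the factor 1 - n
  invertible when the divergence is prescribed.\<close>

locale metric_vector_space =
  fixes g :: "'a::real_vector \<Rightarrow> 'a \<Rightarrow> real"
  assumes dim_ge_2: "dim (UNIV :: 'a set) \<ge> 2"
    and metric: "nondegenerate_metric g"
begin

lemma bilinear_g: "bilinear g"
  and g_sym: "g x y = g y x"
  using metric by (auto simp: nondegenerate_metric_def)

lemma linear_g: "linear (g x)"
  using bilinear_g by (auto simp: bilinear_def)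

lemma g_eqI:
  assumes "\<And>z. g x z = g y z"
  shows "x = y"
proof -
  have "g (x - y) z = 0" for z
    using assms by (simp add: bilinear_lsub[OF bilinear_g])
  then show ?thesis
    using metric unfolding nondegenerate_metric_def by fastforce
qed

lemma riesz: "\<exists>x. \<forall>y. g x y = dual_apply \<xi> y"
proof -
  obtain B :: "'a set" where B: "finite B" "independent B" "span B = UNIV"
    using finite_basis_exists dim_ge_2 by (metis less_le_trans pos2)
  \<comment> \<open>Storing the values \<open>g x b\<close> as coordinates turns \<open>g\<close>
    into an endomorphism, injective by nondegeneracy and hence surjective.\<close>
  define f where "f x = (\<Sum>b\<in>B. g x b *\<^sub>R b)" for x
  have lin: "linear f"
    unfolding f_def using bilinear_g
    by (intro linearI) (simp_all add: bilinear_ladd bilinear_lmul scaleR_add_left sum.distrib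
        scaleR_sum_right)
  have agree: "h x = k x" if "linear h" "linear k"
      "\<And>b. b \<in> B \<Longrightarrow> h b = k b" for h k :: "'a \<Rightarrow> real" and x
    using linear_eq_on_span[OF that(1,2), of B x] that(3) B(3) by auto
  have "inj f"
  proof (subst linear_injective_0[OF lin], intro allI impI)
    fix x assume "f x = 0"
    then have "g x b = 0" if "b \<in> B" for b
      using real_vector.independentD[OF B(2,1) order_refl _ that] unfolding f_def by fastforce
    note gx = this
    have "g x y = g 0 y" for y
      by (rule agree[OF linear_g linear_g]) (simp add: gx bilinear_lzero[OF bilinear_g])
    then show "x = 0" by (rule g_eqI)
  qed
  then obtain x where x: "f x = (\<Sum>b\<in>B. dual_apply \<xi> b *\<^sub>R b)"
    using linear_inj_imp_surj_fin[OF B(1,3) lin] by (metis surjD)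
  have "g x b = dual_apply \<xi> b" if "b \<in> B" for b
  proof -
    have "(\<Sum>b\<in>B. (g x b - dual_apply \<xi> b) *\<^sub>R b) = 0"
      using x by (simp add: f_def scaleR_diff_left sum_subtractf)
    then show ?thesis
      using real_vector.independentD[OF B(2,1) order_refl _ that] by fastforce
  qed
  note gx = this
  have "g x y = dual_apply \<xi> y" for y
    by (rule agree[OF linear_g linear_dual_apply gx])
  then show ?thesis by blast
qed

definition sharp :: "'a dual_space \<Rightarrow> 'a" where
  "sharp \<xi> = (THE x. \<forall>y. g x y = dual_apply \<xi> y)"

lemma g_sharp: "g (sharp \<xi>) y = dual_apply \<xi> y"
proof -
  have "\<exists>!x. \<forall>y. g x y = dual_apply \<xi> y"
    using riesz[of \<xi>] g_eqI by metis
  from theI'[OF this] show ?thesis by (simp add: sharp_def)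
qed

lemma sharp_eqI: "(\<And>y. g x y = dual_apply \<xi> y) \<Longrightarrow> sharp \<xi> = x"
  by (rule g_eqI) (simp add: g_sharp)

lemma linear_sharp: "linear sharp"
  by (intro linearI sharp_eqI)
     (simp_all add: bilinear_ladd[OF bilinear_g] bilinear_lmul[OF bilinear_g]
         g_sharp dual_apply_simps)

text \<open>\<open>pos\<close> and \<open>neg\<close> identify the vector space with
  \<open>E_plus g\<close> and \<open>E_minus g\<close>, where the pairing becomes \<open>g\<close>
  and its negative. \<open>pos_part\<close> and \<open>neg_part\<close> are the coordinates of this
  orthogonal splitting.\<close>

definition pos :: "'a \<Rightarrow> 'a gen" where "pos x = (x, Dual (g x))"
definition neg :: "'a \<Rightarrow> 'a gen" where "neg x = (x, - Dual (g x))"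
definition pos_part :: "'a gen \<Rightarrow> 'a" where "pos_part u = (1/2) *\<^sub>R (fst u + sharp (snd u))"
definition neg_part :: "'a gen \<Rightarrow> 'a" where "neg_part u = (1/2) *\<^sub>R (fst u - sharp (snd u))"

lemma dual_apply_flat: "dual_apply (Dual (g x)) y = g x y"
  by (simp add: dual_apply_Dual[OF linear_g])

lemma flat_add: "Dual (g (x + y)) = Dual (g x) + Dual (g y)"
  and flat_scale: "Dual (g (c *\<^sub>R x)) = c *\<^sub>R Dual (g x)"
  by (rule dual_eqI; simp add: dual_apply_flat dual_apply_simps bilinear_ladd[OF bilinear_g]
      bilinear_lmul[OF bilinear_g])+

lemma linear_pos: "linear pos" and linear_neg: "linear neg"
  by (auto intro!: linearI simp: pos_def neg_def flat_add flat_scale)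

lemma linear_pos_part: "linear pos_part" and linear_neg_part: "linear neg_part"
  by (auto intro!: linearI simp: pos_part_def neg_part_def linear_add[OF linear_sharp]
      linear_scale[OF linear_sharp]
      algebra_simps)

lemma sharp_flat: "sharp (Dual (g x)) = x" "sharp (- Dual (g x)) = - x"
  by (auto intro!: sharp_eqI simp: dual_apply_flat dual_apply_simps bilinear_lneg[OF bilinear_g])

lemma flat_sharp: "Dual (g (sharp \<xi>)) = \<xi>"
  by (rule dual_eqI) (simp add: dual_apply_flat g_sharp)

lemma pos_part_pos [simp]: "pos_part (pos x) = x" and neg_part_pos [simp]: "neg_part (pos x) = 0"
  and pos_part_neg [simp]: "pos_part (neg x) = 0" and neg_part_neg [simp]: "neg_part (neg x) = x"
  by (simp_all add: pos_part_def neg_part_def pos_def neg_def sharp_flat scaleR_2[symmetric])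

lemma split_gen: "u = pos (pos_part u) + neg (neg_part u)"
proof -
  have "pos_part u + neg_part u = fst u" "pos_part u - neg_part u = sharp (snd u)"
    by (simp_all add: pos_part_def neg_part_def algebra_simps scaleR_add_left[symmetric])
  moreover have "pos (pos_part u) + neg (neg_part u)
      = (pos_part u + neg_part u, Dual (g (pos_part u - neg_part u)))"
    using flat_add[of "pos_part u - neg_part u" "neg_part u"]
    by (simp add: pos_def neg_def algebra_simps)
  ultimately show ?thesis by (simp add: flat_sharp)
qed

lemma E_plus_eq: "E_plus g = range pos" and E_minus_eq: "E_minus g = range neg"
  by (auto simp: E_plus_def E_minus_def pos_def neg_def)

lemma pairing_pos_pos [simp]: "pairing (pos x) (pos y) = g x y"
  and pairing_neg_neg [simp]: "pairing (neg x) (neg y) = - g x y"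
  and pairing_pos_neg [simp]: "pairing (pos x) (neg y) = 0"
  and pairing_neg_pos [simp]: "pairing (neg x) (pos y) = 0"
  by (simp_all add: pairing_def pos_def neg_def dual_apply_flat dual_apply_simps g_sym)

lemma bilinear_pairing: "bilinear (pairing :: 'a gen \<Rightarrow> _)"
  unfolding bilinear_def
  by (auto intro!: linearI simp: pairing_def dual_apply_simps linear_add[OF linear_dual_apply]
      linear_scale[OF linear_dual_apply] field_simps)

lemma pairing_sym: "pairing u v = pairing v (u :: 'a gen)"
  by (simp add: pairing_def)

lemma pairing_eq: "pairing u v = g (pos_part u) (pos_part v) - g (neg_part u) (neg_part v)"
  by (subst split_gen[of u], subst split_gen[of v])
     (simp add: bilinear_ladd[OF bilinear_pairing] bilinear_radd[OF bilinear_pairing])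

lemma pairing_eqI:
  assumes "\<And>w. pairing u w = pairing v (w :: 'a gen)"
  shows "u = v"
proof -
  have "pos_part u = pos_part v"
    using assms[of "pos z" for z]
    by (intro g_eqI) (simp add: pairing_eq bilinear_rzero[OF bilinear_g])
  moreover have "neg_part u = neg_part v"
    using assms[of "neg z" for z]
    by (intro g_eqI) (simp add: pairing_eq bilinear_rzero[OF bilinear_g])
  ultimately show ?thesis
    using split_gen[of u] split_gen[of v] by simp
qed

lemma pairing_riesz:
  assumes "linear l"
  shows "\<exists>u :: 'a gen. \<forall>v. l v = pairing v u"
proof -
  have lin: "linear (\<lambda>x. l (pos x))" "linear (\<lambda>x. l (neg x))"
    using linear_compose[OF linear_pos assms] linear_compose[OF linear_neg assms]
    by (auto simp: o_def)
  let ?u = "pos (sharp (Dual (\<lambda>x. l (pos x)))) - neg (sharp (Dual (\<lambda>x. l (neg x))))"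
  have "l v = pairing v ?u" for v
  proof -
    have "l v = l (pos (pos_part v)) + l (neg (neg_part v))"
      by (metis split_gen linear_add[OF assms])
    also have "\<dots> = pairing ?u v"
      by (simp add: pairing_eq linear_diff[OF linear_pos_part] linear_diff[OF linear_neg_part]
          g_sharp
          dual_apply_Dual[OF lin(1)] dual_apply_Dual[OF lin(2)] bilinear_lneg[OF bilinear_g])
    finally show ?thesis by (simp add: pairing_sym)
  qed
  then show ?thesis by blast
qed

text \<open>The \<open>THE\<close> in \<open>pairing_adjoint\<close> is well defined:
  \<open>pairing_riesz\<close> gives existence, nondegeneracy of the pairing gives
  uniqueness.\<close>

lemma pairing_pairing_adjoint:
  fixes f :: "'a gen \<Rightarrow> 'a gen"
  assumes "linear f"
  shows "pairing v (pairing_adjoint f w) = pairing (f v) w"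
proof -
  have "linear (\<lambda>v. pairing (f v) w)" for w
    using linear_compose[OF assms, of "\<lambda>u. pairing u w"] bilinear_pairing
    unfolding bilinear_def o_def by blast
  then have "\<exists>u. \<forall>v. pairing (f v) w = pairing v u" for w
    by (rule pairing_riesz)
  then obtain f' where f': "\<forall>v w. pairing (f v) w = pairing v (f' w)"
    by metis
  moreover have "h = f'" if "\<forall>v w. pairing (f v) w = pairing v (h w)" for h
    using f' that by (intro ext pairing_eqI) (metis pairing_sym)
  ultimately have "\<exists>!f'. \<forall>v w. pairing (f v) w = pairing v (f' w)"
    by blast
  from theI'[OF this, folded pairing_adjoint_def] show ?thesis by (simp only:)
qed

lemma finite_span_gen: "\<exists>S :: 'a gen set. finite S \<and> UNIV \<subseteq> span S"
proof -
  obtain B :: "'a set" where B: "finite B" "span B = UNIV"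
    using finite_basis_exists dim_ge_2 by (metis less_le_trans pos2)
  have "u \<in> span (pos ` B \<union> neg ` B)" for u
  proof -
    have "pos (pos_part u) \<in> span (pos ` B)" "neg (neg_part u) \<in> span (neg ` B)"
      using B(2) by (simp_all add: linear_span_image linear_pos linear_neg)
    then show ?thesis
      by (subst split_gen) (meson span_add span_mono sup_ge1 sup_ge2 subsetD)
  qed
  then show ?thesis using B(1) by (intro exI[of _ "pos ` B \<union> neg ` B"]) auto
qed

lemma finite_span: "\<exists>S :: 'a set. finite S \<and> UNIV \<subseteq> span S"
  using finite_basis_exists dim_ge_2 by (metis less_le_trans pos2 order_refl)

lemma subspace_E_plus: "subspace (E_plus g)" and subspace_E_minus: "subspace (E_minus g)"
  using linear_subspace_image[OF linear_pos subspace_UNIV]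
      linear_subspace_image[OF linear_neg subspace_UNIV]
  by (simp_all add: E_plus_eq E_minus_eq)

end

section \<open>Levi-Civita connections and Ricci curvature\<close>

text \<open>Taking \<open>P\<close> and \<open>M\<close> as data avoids constructing the Levi-Civita
  connection of \<open>g\<close>, which is their mean: skewness makes the mean metric,
  \<open>br_eq\<close> and the alternation of \<open>H\<close> make it torsion-free.\<close>

locale mixed_bracket = metric_vector_space g
  for g :: "'a::real_vector \<Rightarrow> 'a \<Rightarrow> real" +
  fixes br :: "'a \<Rightarrow> 'a \<Rightarrow> 'a" and H :: "'a \<Rightarrow> 'a \<Rightarrow> 'a \<Rightarrow> real" and P M :: "'a \<Rightarrow> 'a \<Rightarrow> 'a"
  assumes bilinear_P: "bilinear P" and bilinear_M: "bilinear M"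
    and P_skew: "g (P x y) z = - g (P x z) y" and M_skew: "g (M x y) z = - g (M x z) y"
    and br_eq: "br x y = P x y - M y x"
    and H_eq: "H x y z = g (P x y) z - g (M x y) z"
    and three_form: "three_form H"
begin

lemmas P_rules = bilinear_rules[OF bilinear_P]
lemmas M_rules = bilinear_rules[OF bilinear_M]
lemmas g_rules = bilinear_rules[OF bilinear_g]
lemmas pairing_rules = bilinear_rules[OF bilinear_pairing]
lemmas split_rules = linear_rules[OF linear_pos] linear_rules[OF linear_neg]
  linear_rules[OF linear_pos_part] linear_rules[OF linear_neg_part]

lemma linear_br: "linear (br x)" "linear (\<lambda>x. br x y)"
  by (auto intro!: linearI simp: br_eq P_rules M_rules algebra_simps)

lemma linear_H: "linear (H x y)"
  using three_form by (simp add: three_form_def)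

text \<open>Alternation in the first two and in the last two arguments, polarised, gives two
  transpositions whose composite is the cyclic shift.\<close>

lemma H_cyclic: "H x y z = H y z x"
proof -
  have add: "H (a + b) c d = H a c d + H b c d" "H c (a + b) d = H c a d + H c b d"
    "H c d (a + b) = H c d a + H c d b" for a b c d
    by (simp_all add: H_eq P_rules M_rules g_rules)
  have alt: "H a a b = 0" "H b a a = 0" for a b
    using three_form by (simp_all add: three_form_def)
  have "H x y z + H y x z = 0" "H y x z + H y z x = 0"
    using alt(1)[of "x + y" z, unfolded add] alt(2)[of y "x + z", unfolded add]
    by (simp_all add: alt add.commute)
  then show ?thesis by linarith
qed

section \<open>The Dorfman bracket in terms of the splitting\<close>

lemma dual_apply_coad: "dual_apply (coad br x \<eta>) y = dual_apply \<eta> (br x y)"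
  using linear_compose[OF linear_br(1) linear_dual_apply]
  by (simp add: coad_def dual_apply_Dual o_def)

lemma pairing_dorfman:
  "pairing (dorfman br H u v) w = (dual_apply (snd w) (br (fst u) (fst v))
    - dual_apply (snd v) (br (fst u) (fst w)) + dual_apply (snd u) (br (fst v) (fst w))
    + H (fst u) (fst v) (fst w)) / 2"
  by (simp add: pairing_def dorfman_def dual_apply_simps dual_apply_coad dual_apply_Dual linear_H)

lemma bilinear_dorfman: "bilinear (dorfman br H)"
  unfolding bilinear_def
  by (auto intro!: linearI pairing_eqI simp del: split_paired_All simp: pairing_dorfman
      pairing_rules dual_apply_simps
      linear_rules[OF linear_dual_apply] linear_rules[OF linear_br(1)] linear_rules[OF linear_br(2)]
      H_eq P_rules M_rules g_rules field_simps)

text \<open>Values 1 or -1 of \<open>s\<close>, \<open>t\<close>, \<open>r\<close> select the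
  summand of each argument, so one formula covers all eight types. \<open>H_eq\<close> eliminates
  \<open>M\<close>; skewness leaves \<open>P\<close> in the three cyclic orders.\<close>

lemma pairing_dorfman_sign:
  assumes "u = (x, s *\<^sub>R Dual (g x))" "v = (y, t *\<^sub>R Dual (g y))" "w = (z, r *\<^sub>R Dual (g z))"
  shows "2 * pairing (dorfman br H u v) w = r * (g (P x y) z + g (P y z) x - H x y z)
    + t * (g (P x y) z + g (P z x) y - H x y z) + s * (g (P y z) x + g (P z x) y - H x y z)
        + H x y z"
proof -
  have "H x y z = g (P x y) z - g (M x y) z" "H x y z = g (P y z) x - g (M y z) x"
    "H x y z = g (P z x) y - g (M z x) y"
    using H_eq H_cyclic by metis+
  then have m: "g z (M x y) = g (P x y) z - H x y z" "g z (M y x) = - g (P y z) x + H x y z"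
    "g y (M z x) = g (P z x) y - H x y z" "g x (M z y) = - g (P z x) y + H x y z"
    using M_skew[of y x z] M_skew[of z y x] by (simp_all add: g_sym[of _ "M _ _"])
  have p: "g z (P x y) = g (P x y) z" "g y (P x z) = - g (P x y) z" "g x (P y z) = g (P y z) x"
    using P_skew[of x z y] by (simp_all add: g_sym[of _ "P _ _"])
  show ?thesis
    unfolding pairing_dorfman assms
    by (simp add: dual_apply_simps dual_apply_flat br_eq g_rules m p field_simps)
qed

lemma pos_sign: "pos x = (x, 1 *\<^sub>R Dual (g x))" and neg_sign: "neg x = (x, (-1) *\<^sub>R Dual (g x))"
  by (simp_all add: pos_def neg_def)

lemma dorfman_pos_neg: "dorfman br H (pos x) (neg y) = neg (M x y) - pos (P y x)"
proof (rule pairing_eqI)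
  fix w
  have p: "pairing (dorfman br H (pos x) (neg y)) (pos z) = - g (P y x) z"
    "pairing (dorfman br H (pos x) (neg y)) (neg z) = - g (M x y) z" for z
    using pairing_dorfman_sign[OF pos_sign neg_sign pos_sign, of x y z]
      pairing_dorfman_sign[OF pos_sign neg_sign neg_sign, of x y z] P_skew[of y z x] H_eq[of x y z]
    by auto
  show "pairing (dorfman br H (pos x) (neg y)) w = pairing (neg (M x y) - pos (P y x)) w"
    by (subst (1 2) split_gen[of w]) (simp add: pairing_rules p)
qed

lemma dorfman_neg_pos: "dorfman br H (neg x) (pos y) = pos (P x y) - neg (M y x)"
proof (rule pairing_eqI)
  fix w
  have p: "pairing (dorfman br H (neg x) (pos y)) (pos z) = g (P x y) z"
    "pairing (dorfman br H (neg x) (pos y)) (neg z) = g (M y x) z" for z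
    using pairing_dorfman_sign[OF neg_sign pos_sign pos_sign, of x y z]
      pairing_dorfman_sign[OF neg_sign pos_sign neg_sign, of x y z] M_skew[of y z x] H_eq[of y z x]
      H_cyclic[of x y z]
    by auto
  show "pairing (dorfman br H (neg x) (pos y)) w = pairing (pos (P x y) - neg (M y x)) w"
    by (subst (1 2) split_gen[of w]) (simp add: pairing_rules p)
qed

section \<open>Torsion and an explicit family of Levi-Civita connections\<close>

lemma pairing_torsion:
  assumes "bilinear D"
  shows "pairing (torsion br H D u v) w
    = pairing (D u v) w - pairing (D v u) w - pairing (dorfman br H u v) w + pairing (D w u) v"
proof -
  have "linear (\<lambda>w. D w u)"
    using assms by (simp add: bilinear_def del: split_paired_All)
  then have "pairing (pairing_adjoint (\<lambda>w. D w u) v) w = pairing (D w u) v"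
    by (metis pairing_pairing_adjoint pairing_sym)
  then show ?thesis
    by (simp add: torsion_def pairing_rules)
qed

text \<open>The lowered form \<open>g (skew_part a x y) z\<close> is skew in \<open>y, z\<close> and has vanishing cyclic sum, so
  \<open>skew_part\<close> can be added to a connection without affecting torsion or metricity; its trace
  is what allows the divergence to be prescribed.\<close>

definition skew_part :: "'a \<Rightarrow> 'a \<Rightarrow> 'a \<Rightarrow> 'a" where
  "skew_part a x y = g x y *\<^sub>R a - g a y *\<^sub>R x"

text \<open>The mixed components are forced by the torsion.  Of the pure components the torsion only fixes
  the totally skew part, which is a third of the cyclic sum; the coefficients \<open>2/3\<close> and \<open>1/3\<close>
  come from expressing that part of the bracket through \<open>P\<close> and \<open>M\<close>.\<close>

definition lc_conn :: "'a \<Rightarrow> 'a \<Rightarrow> 'a gen \<Rightarrow> 'a gen \<Rightarrow> 'a gen" where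
  "lc_conn a b u v =
     pos ((1/3) *\<^sub>R (2 *\<^sub>R P (pos_part u) (pos_part v) + M (pos_part u) (pos_part v))
         + P (neg_part u) (pos_part v) + skew_part a (pos_part u) (pos_part v))
   + neg ((1/3) *\<^sub>R (P (neg_part u) (neg_part v) + 2 *\<^sub>R M (neg_part u) (neg_part v))
       + M (pos_part u) (neg_part v) + skew_part b (neg_part u) (neg_part v))"

lemma bilinear_lc_conn: "bilinear (lc_conn a b)"
  unfolding bilinear_def lc_conn_def skew_part_def
  by (intro conjI allI; rule linearI;
      simp add: split_rules P_rules M_rules g_rules algebra_simps)

lemma lc_conn_simps:
  "lc_conn a b (pos x) (pos y) = pos ((1/3) *\<^sub>R (2 *\<^sub>R P x y + M x y) + skew_part a x y)"
  "lc_conn a b (neg x) (pos y) = pos (P x y)"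
  "lc_conn a b (pos x) (neg y) = neg (M x y)"
  "lc_conn a b (neg x) (neg y) = neg ((1/3) *\<^sub>R (P x y + 2 *\<^sub>R M x y) + skew_part b x y)"
  by (simp_all add: lc_conn_def skew_part_def split_rules P_rules M_rules g_rules)

lemma pairing_lc_conn: "pairing (lc_conn a b u v) w + pairing v (lc_conn a b u w) = 0"
proof -
  note skews = P_skew[of "pos_part u" "pos_part v" "pos_part w"] M_skew[of "pos_part u"
      "pos_part v" "pos_part w"]
    P_skew[of "neg_part u" "pos_part v" "pos_part w"] P_skew[of "neg_part u" "neg_part v"
        "neg_part w"]
    M_skew[of "neg_part u" "neg_part v" "neg_part w"] M_skew[of "pos_part u" "neg_part v"
        "neg_part w"]
  show ?thesis
    unfolding pairing_sym[of v]
    by (simp add: pairing_eq lc_conn_def skew_part_def split_rules P_rules M_rules g_rules skews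
        algebra_simps)
qed

text \<open>\<open>T\<close> is trilinear, so the eight sign types suffice. In a pure type,
  metricity turns \<open>T\<close> into the cyclic sum of the connection minus the bracket, and the
  \<open>skew_part\<close> terms cancel in that sum.\<close>

lemma torsion_lc_conn: "torsion br H (lc_conn a b) u v = 0"
proof (rule pairing_eqI)
  fix w
  define T where "T u v w = pairing (lc_conn a b u v) w - pairing (lc_conn a b v u) w
     - pairing (dorfman br H u v) w + pairing (lc_conn a b w u) v" for u v w
  have add: "T (u + u') v w = T u v w + T u' v w" "T u (v + v') w = T u v w + T u v' w"
    "T u v (w + w') = T u v w + T u v w'" for u u' v v' w w'
    by (simp_all add: T_def pairing_rules bilinear_rules[OF bilinear_lc_conn]
        bilinear_rules[OF bilinear_dorfman])
  have 0: "T (pos x) (pos y) (pos z) = 0" "T (pos x) (pos y) (neg z) = 0"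
     "T (pos x) (neg y) (pos z) = 0" "T (pos x) (neg y) (neg z) = 0"
     "T (neg x) (pos y) (pos z) = 0" "T (neg x) (pos y) (neg z) = 0"
     "T (neg x) (neg y) (pos z) = 0" "T (neg x) (neg y) (neg z) = 0" for x y z
  proof -
    have h: "g (M x y) z = g (P x y) z - H x y z" "g (M y z) x = g (P y z) x - H x y z"
      "g (M z x) y = g (P z x) y - H x y z"
      using H_eq H_cyclic by (metis diff_diff_eq2 add_diff_cancel_left' add.commute)+
    note sk = P_skew[of x z y] P_skew[of y x z] P_skew[of z y x]
       M_skew[of x z y] M_skew[of y x z] M_skew[of z y x] g_sym[of y x] g_sym[of z x] g_sym[of z y]
    show "T (pos x) (pos y) (pos z) = 0"
      using pairing_dorfman_sign[OF pos_sign pos_sign pos_sign, of x y z]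
      by (simp add: T_def lc_conn_simps skew_part_def g_rules sk h field_simps)
    show "T (pos x) (pos y) (neg z) = 0"
      using pairing_dorfman_sign[OF pos_sign pos_sign neg_sign, of x y z]
      by (simp add: T_def lc_conn_simps skew_part_def g_rules sk h field_simps)
    show "T (pos x) (neg y) (pos z) = 0"
      using pairing_dorfman_sign[OF pos_sign neg_sign pos_sign, of x y z]
      by (simp add: T_def lc_conn_simps skew_part_def g_rules sk h field_simps)
    show "T (pos x) (neg y) (neg z) = 0"
      using pairing_dorfman_sign[OF pos_sign neg_sign neg_sign, of x y z]
      by (simp add: T_def lc_conn_simps skew_part_def g_rules sk h field_simps)
    show "T (neg x) (pos y) (pos z) = 0"
      using pairing_dorfman_sign[OF neg_sign pos_sign pos_sign, of x y z]
      by (simp add: T_def lc_conn_simps skew_part_def g_rules sk h field_simps)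
    show "T (neg x) (pos y) (neg z) = 0"
      using pairing_dorfman_sign[OF neg_sign pos_sign neg_sign, of x y z]
      by (simp add: T_def lc_conn_simps skew_part_def g_rules sk h field_simps)
    show "T (neg x) (neg y) (pos z) = 0"
      using pairing_dorfman_sign[OF neg_sign neg_sign pos_sign, of x y z]
      by (simp add: T_def lc_conn_simps skew_part_def g_rules sk h field_simps)
    show "T (neg x) (neg y) (neg z) = 0"
      using pairing_dorfman_sign[OF neg_sign neg_sign neg_sign, of x y z]
      by (simp add: T_def lc_conn_simps skew_part_def g_rules sk h field_simps)
  qed
  have "T u v w = 0"
    by (subst split_gen[of u], subst split_gen[of v], subst split_gen[of w]) (simp add: add 0)
  then show "pairing (torsion br H (lc_conn a b) u v) w = pairing 0 w"
    by (simp add: pairing_torsion[OF bilinear_lc_conn] T_def pairing_rules)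
qed

lemma levi_civita_lc_conn: "levi_civita br H g (lc_conn a b)"
proof -
  have "lc_conn a b u (pos x) \<in> range pos" "lc_conn a b u (neg x) \<in> range neg" for u x
    by (simp_all add: lc_conn_def skew_part_def linear_0[OF linear_pos] linear_0[OF linear_neg]
        P_rules M_rules g_rules)
  then show ?thesis
    using bilinear_lc_conn pairing_lc_conn torsion_lc_conn
    unfolding levi_civita_def generalized_connection_def E_plus_eq E_minus_eq by blast
qed

lemma linear_left: "bilinear D \<Longrightarrow> linear (\<lambda>u. D u v)"
  and linear_right: "bilinear D \<Longrightarrow> linear (D u)"
  for D :: "'a gen \<Rightarrow> 'a gen \<Rightarrow> 'a gen"
  by (simp_all add: bilinear_def del: split_paired_All)

section \<open>Prescribing the divergence\<close>

lemma linear_divergence: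
  fixes D :: "'a gen \<Rightarrow> 'a gen \<Rightarrow> 'a gen"
  assumes "bilinear D"
  shows "linear (\<lambda>v. trace_on UNIV (\<lambda>u. D u v))"
proof (rule linearI)
  show "trace_on UNIV (\<lambda>u. D u (v + w))
      = trace_on UNIV (\<lambda>u. D u v) + trace_on UNIV (\<lambda>u. D u w)" for v w
    unfolding bilinear_radd[OF assms] by (rule trace_on_add) auto
  show "trace_on UNIV (\<lambda>u. D u (c *\<^sub>R v)) = c *\<^sub>R trace_on UNIV (\<lambda>u. D u v)" for c v
    unfolding bilinear_rmul[OF assms] real_scaleR_def by (rule trace_on_scaleR) auto
qed

lemma divergence_apply:
  fixes D :: "'a gen \<Rightarrow> 'a gen \<Rightarrow> 'a gen"
  assumes "bilinear D"
  shows "dual_apply (divergence D) v = trace_on UNIV (\<lambda>u. D u v)"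
  unfolding divergence_def by (simp add: dual_apply_Dual[OF linear_divergence[OF assms]])

lemma pos_mem [simp]: "pos x \<in> E_plus g" and neg_mem [simp]: "neg x \<in> E_minus g"
  by (simp_all add: E_plus_eq E_minus_eq)

text \<open>Cyclicity brings \<open>pos_part\<close> and \<open>pos\<close> together, where they
  cancel; likewise for \<open>neg\<close>.\<close>

lemma trace_split:
  assumes "linear f" "linear h"
  shows "trace_on UNIV (\<lambda>u. pos (f (pos_part u))) = trace_on UNIV f"
    and "trace_on UNIV (\<lambda>u. neg (h (neg_part u))) = trace_on UNIV h"
proof -
  obtain S :: "'a gen set" and T :: "'a set" where fin: "finite S" "UNIV \<subseteq> span S" "finite T"
      "UNIV \<subseteq> span T"
    using finite_span_gen finite_span by blast
  show "trace_on UNIV (\<lambda>u. pos (f (pos_part u))) = trace_on UNIV f"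
    using trace_on_commute[OF subspace_UNIV fin(1,2) subspace_UNIV fin(3,4),
        of "\<lambda>x. pos (f x)" pos_part]
      linear_compose[OF assms(1) linear_pos] linear_pos_part by (simp add: o_def)
  show "trace_on UNIV (\<lambda>u. neg (h (neg_part u))) = trace_on UNIV h"
    using trace_on_commute[OF subspace_UNIV fin(1,2) subspace_UNIV fin(3,4),
        of "\<lambda>x. neg (h x)" neg_part]
      linear_compose[OF assms(2) linear_neg] linear_neg_part by (simp add: o_def)
qed

lemma linear_skew_part: "linear (\<lambda>x. skew_part a x y)"
  by (auto intro!: linearI simp: skew_part_def g_rules algebra_simps)

text \<open>A rank-one map of trace \<open>g a y\<close> minus \<open>g a y\<close> times the
  identity.\<close>

lemma trace_skew_part: "trace_on UNIV (\<lambda>x. skew_part a x y)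
    = (1 - real (dim (UNIV :: 'a set))) * g a y"
proof -
  obtain T :: "'a set" where fin: "finite T" "UNIV \<subseteq> span T"
    using finite_span by blast
  have "trace_on UNIV (\<lambda>x. g x y *\<^sub>R a) = g a y"
    using bilinear_g by (intro trace_on_rank_one[OF subspace_UNIV fin]) (auto simp: bilinear_def)
  moreover have "trace_on UNIV (\<lambda>x::'a. g a y *\<^sub>R x) = g a y * dim (UNIV :: 'a set)"
    by (subst trace_on_scaleR[OF subspace_UNIV]) (simp_all add: trace_on_ident)
  moreover have "trace_on UNIV (\<lambda>x. skew_part a x y)
      = trace_on UNIV (\<lambda>x. g x y *\<^sub>R a) - trace_on UNIV (\<lambda>x::'a. g a y *\<^sub>R x)"
    unfolding skew_part_def by (subst trace_on_diff) auto
  ultimately show ?thesis by (simp add: algebra_simps)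
qed

lemma divergence_lc_conn:
  "dual_apply (divergence (lc_conn a b)) v = dual_apply (divergence (lc_conn 0 0)) v
     + (1 - real (dim (UNIV :: 'a set))) * (g a (pos_part v) + g b (neg_part v))"
proof -
  have "trace_on UNIV (\<lambda>u. lc_conn a b u v) = trace_on UNIV (\<lambda>u. lc_conn 0 0 u v
      + (pos (skew_part a (pos_part u) (pos_part v))
          + neg (skew_part b (neg_part u) (neg_part v))))"
    by (rule arg_cong[of _ _ "trace_on UNIV"])
       (simp add: fun_eq_iff lc_conn_def skew_part_def split_rules g_rules del: split_paired_All)
  also have "\<dots> = trace_on UNIV (\<lambda>u. lc_conn 0 0 u v)
     + (trace_on UNIV (\<lambda>u. pos (skew_part a (pos_part u) (pos_part v)))
         + trace_on UNIV (\<lambda>u. neg (skew_part b (neg_part u) (neg_part v))))"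
    by (simp only: trace_on_add[OF subspace_UNIV subset_UNIV subset_UNIV])
  also have "\<dots> = trace_on UNIV (\<lambda>u. lc_conn 0 0 u v)
     + (1 - real (dim (UNIV :: 'a set))) * (g a (pos_part v) + g b (neg_part v))"
    using trace_split[OF linear_skew_part[of a "pos_part v"] linear_skew_part[of b "neg_part v"]]
    by (simp add: trace_skew_part algebra_simps)
  finally show ?thesis by (simp add: divergence_apply bilinear_lc_conn)
qed

text \<open>This makes the \<open>SOME\<close> in \<open>levi_civita_choice\<close> meaningful. The
  divergence of \<open>lc_conn a b\<close> is affine in \<open>a\<close>, \<open>b\<close> with
  invertible linear part, so the deficit \<open>\<epsilon>\<close> is attained by raising its
  restrictions to the two summands with \<open>g\<close>.\<close>

lemma levi_civita_with_divergence_exists: "\<exists>D. levi_civita br H g D \<and> divergence D = \<delta>"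
proof -
  define n where "n = real (dim (UNIV :: 'a set))"
  define \<epsilon> where "\<epsilon> = \<delta> - divergence (lc_conn 0 0)"
  have n: "1 - n \<noteq> 0"
    using dim_ge_2 by (simp add: n_def)
  have lin: "linear (\<lambda>x. dual_apply \<epsilon> (pos x))" "linear (\<lambda>x. dual_apply \<epsilon> (neg x))"
    using linear_compose[OF linear_pos linear_dual_apply]
        linear_compose[OF linear_neg linear_dual_apply]
    by (auto simp: o_def)
  define a where "a = (1 / (1 - n)) *\<^sub>R sharp (Dual (\<lambda>x. dual_apply \<epsilon> (pos x)))"
  define b where "b = (1 / (1 - n)) *\<^sub>R sharp (Dual (\<lambda>x. dual_apply \<epsilon> (neg x)))"
  have ab: "(1 - n) * g a x = dual_apply \<epsilon> (pos x)" "(1 - n) * g b x = dual_apply \<epsilon> (neg x)" for x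
    using n by (simp_all add: a_def b_def g_rules g_sharp dual_apply_Dual lin)
  have "divergence (lc_conn a b) = \<delta>"
  proof (rule dual_eqI)
    fix v
    have "dual_apply \<epsilon> (pos (pos_part v)) + dual_apply \<epsilon> (neg (neg_part v)) = dual_apply \<epsilon> v"
      using split_gen[of v] linear_add[OF linear_dual_apply] by metis
    then show "dual_apply (divergence (lc_conn a b)) v = dual_apply \<delta> v"
      using divergence_lc_conn[of a b v, folded n_def, unfolded distrib_left ab]
      by (simp add: \<epsilon>_def dual_apply_simps)
  qed
  then show ?thesis using levi_civita_lc_conn by blast
qed

section \<open>Curvature of an arbitrary Levi-Civita connection\<close>

context
  fixes D :: "'a gen \<Rightarrow> 'a gen \<Rightarrow> 'a gen"
  assumes D: "levi_civita br H g D"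
begin

lemma bilinear_D: "bilinear D"
  using D by (simp add: levi_civita_def generalized_connection_def del: split_paired_All)

lemma D_plus: "\<exists>y. D u (pos x) = pos y" and D_minus: "\<exists>y. D u (neg x) = neg y"
  using D unfolding levi_civita_def E_plus_eq E_minus_eq by blast+

lemma D_mem: "v \<in> E_plus g \<Longrightarrow> D u v \<in> E_plus g" "v \<in> E_minus g \<Longrightarrow> D u v \<in> E_minus g"
  using D unfolding levi_civita_def by blast+

lemma D_torsion:
  "pairing (D u v) w = pairing (dorfman br H u v) w + pairing (D v u) w - pairing (D w u) v"
proof -
  have "torsion br H D u v = 0"
    using D unfolding levi_civita_def by blast
  then show ?thesis
    using pairing_torsion[OF bilinear_D, of u v w] by (simp add: pairing_rules)
qed

text \<open>Besides the bracket, the torsion identity contains derivatives of \<open>neg x\<close>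
  paired with elements of \<open>E_plus g\<close>. These derivatives stay in
  \<open>E_minus g\<close>, so the pairings vanish.\<close>

lemma D_neg_pos: "D (neg x) (pos y) = pos (P x y)"
proof -
  obtain z where z: "D (neg x) (pos y) = pos z" using D_plus by blast
  have "g z w = g (P x y) w" for w
  proof -
    obtain z1 z2 where "D (pos y) (neg x) = neg z1" "D (pos w) (neg x) = neg z2" using D_minus
    by metis
    then show ?thesis
      using D_torsion[of "neg x" "pos y" "pos w"] z by (simp add: dorfman_neg_pos pairing_rules)
  qed
  then show ?thesis using z g_eqI by metis
qed

lemma D_pos_neg: "D (pos x) (neg y) = neg (M x y)"
proof -
  obtain z where z: "D (pos x) (neg y) = neg z" using D_minus by blast
  have "g z w = g (M x y) w" for w
  proof -
    obtain z1 z2 where "D (neg y) (pos x) = pos z1" "D (neg w) (pos x) = pos z2" using D_plus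
    by metis
    then show ?thesis
      using D_torsion[of "pos x" "neg y" "neg w"] z by (simp add: dorfman_pos_neg pairing_rules)
  qed
  then show ?thesis using z g_eqI by metis
qed

text \<open>\<open>D u (pos x)\<close> always lies in \<open>E_plus g\<close>; commuting with the
  inclusion of \<open>E_plus g\<close> restricts the trace.\<close>

lemma divergence_pos: "dual_apply (divergence D) (pos x) = trace_on (E_plus g) (\<lambda>u. D u (pos x))"
proof -
  obtain S :: "'a gen set" where S: "finite S" "UNIV \<subseteq> span S"
    using finite_span_gen by blast
  then have "E_plus g \<subseteq> span S" by blast
  moreover have "range (\<lambda>u. D u (pos x)) \<subseteq> E_plus g"
    by (auto intro!: D_mem)
  ultimately show ?thesis
    using trace_on_commute[OF subspace_UNIV S subspace_E_plus S(1), of "\<lambda>u. u" "\<lambda>u. D u (pos x)"]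
      linear_left[OF bilinear_D] by (simp add: divergence_apply bilinear_D linear_ident)
qed

lemma divergence_neg: "dual_apply (divergence D) (neg x) = trace_on (E_minus g) (\<lambda>u. D u (neg x))"
proof -
  obtain S :: "'a gen set" where S: "finite S" "UNIV \<subseteq> span S"
    using finite_span_gen by blast
  then have "E_minus g \<subseteq> span S" by blast
  moreover have "range (\<lambda>u. D u (neg x)) \<subseteq> E_minus g"
    by (auto intro!: D_mem)
  ultimately show ?thesis
    using trace_on_commute[OF subspace_UNIV S subspace_E_minus S(1), of "\<lambda>u. u" "\<lambda>u. D u (neg x)"]
      linear_left[OF bilinear_D] by (simp add: divergence_apply bilinear_D linear_ident)
qed

text \<open>The composites \<open>?B (?A w)\<close> and \<open>?A (?B w)\<close> have equal traces
  and cancel, leaving the trace that computes the divergence.\<close>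

lemma ricci_plus_formula:
  assumes "\<And>x y z. P (M x y) z = 0"
  shows "trace_on (E_plus g) (\<lambda>w. curvature br H D w (neg x) (pos y))
      = dual_apply (divergence D) (pos (P x y))"
proof -
  obtain S :: "'a gen set" where S: "finite S" "UNIV \<subseteq> span S"
    using finite_span_gen by blast
  then have S': "E_plus g \<subseteq> span S" by blast
  let ?A = "\<lambda>w. D w (pos y)" and ?B = "D (neg x)"
  have maps: "?A ` E_plus g \<subseteq> E_plus g" "?B ` E_plus g \<subseteq> E_plus g"
    "(\<lambda>w. D w (pos (P x y))) ` E_plus g \<subseteq> E_plus g"
    by (auto intro!: D_mem)
  \<comment> \<open>For \<open>w = pos z\<close> the bracket with \<open>neg x\<close> is
    \<open>neg (M z x) - pos (P x z)\<close>. Its first part contributes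
    \<open>pos (P (M z x) y)\<close> up to sign, zero by assumption; its second part is minus
    \<open>?B w\<close> and gives the last summand.\<close>
  have "curvature br H D w (neg x) (pos y)
      = D w (pos (P x y)) - ?B (?A w) + ?A (?B w)" if w: "w \<in> E_plus g" for w
  proof -
    obtain z where "w = pos z" using w by (auto simp: E_plus_eq)
    then show ?thesis
      by (simp add: curvature_def D_neg_pos dorfman_pos_neg bilinear_rules[OF bilinear_D]
          assms split_rules)
  qed
  then have "trace_on (E_plus g) (\<lambda>w. curvature br H D w (neg x) (pos y))
      = trace_on (E_plus g) (\<lambda>w. D w (pos (P x y)) - ?B (?A w) + ?A (?B w))"
    by (rule trace_on_cong[OF subspace_E_plus])
  also have "\<dots> = trace_on (E_plus g) (\<lambda>w. D w (pos (P x y)) - ?B (?A w))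
      + trace_on (E_plus g) (\<lambda>w. ?A (?B w))"
    by (intro trace_on_add[OF subspace_E_plus]) (auto intro!: D_mem
        subspace_diff[OF subspace_E_plus])
  also have "trace_on (E_plus g) (\<lambda>w. D w (pos (P x y)) - ?B (?A w))
     = trace_on (E_plus g) (\<lambda>w. D w (pos (P x y))) - trace_on (E_plus g) (\<lambda>w. ?B (?A w))"
    using maps by (intro trace_on_diff[OF subspace_E_plus]) (auto intro!: D_mem)
  also have "trace_on (E_plus g) (\<lambda>w. ?A (?B w)) = trace_on (E_plus g) (\<lambda>w. ?B (?A w))"
    using maps linear_left[OF bilinear_D] linear_right[OF bilinear_D]
    by (intro trace_on_commute[OF subspace_E_plus S(1) S' subspace_E_plus S(1) S'])
  finally show ?thesis by (simp add: divergence_pos)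
qed

lemma ricci_minus_formula:
  assumes "\<And>x y z. M (P x y) z = 0"
  shows "trace_on (E_minus g) (\<lambda>w. curvature br H D w (pos x) (neg y))
      = dual_apply (divergence D) (neg (M x y))"
proof -
  obtain S :: "'a gen set" where S: "finite S" "UNIV \<subseteq> span S"
    using finite_span_gen by blast
  then have S': "E_minus g \<subseteq> span S" by blast
  let ?A = "\<lambda>w. D w (neg y)" and ?B = "D (pos x)"
  have maps: "?A ` E_minus g \<subseteq> E_minus g" "?B ` E_minus g \<subseteq> E_minus g"
    "(\<lambda>w. D w (neg (M x y))) ` E_minus g \<subseteq> E_minus g"
    by (auto intro!: D_mem)
  have "curvature br H D w (pos x) (neg y)
      = D w (neg (M x y)) - ?B (?A w) + ?A (?B w)" if w: "w \<in> E_minus g" for w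
  proof -
    obtain z where "w = neg z" using w by (auto simp: E_minus_eq)
    then show ?thesis
      by (simp add: curvature_def D_pos_neg dorfman_neg_pos bilinear_rules[OF bilinear_D]
          assms split_rules)
  qed
  then have "trace_on (E_minus g) (\<lambda>w. curvature br H D w (pos x) (neg y))
      = trace_on (E_minus g) (\<lambda>w. D w (neg (M x y)) - ?B (?A w) + ?A (?B w))"
    by (rule trace_on_cong[OF subspace_E_minus])
  also have "\<dots> = trace_on (E_minus g) (\<lambda>w. D w (neg (M x y)) - ?B (?A w))
      + trace_on (E_minus g) (\<lambda>w. ?A (?B w))"
    by (intro trace_on_add[OF subspace_E_minus]) (auto intro!: D_mem
        subspace_diff[OF subspace_E_minus])
  also have "trace_on (E_minus g) (\<lambda>w. D w (neg (M x y)) - ?B (?A w))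
     = trace_on (E_minus g) (\<lambda>w. D w (neg (M x y))) - trace_on (E_minus g) (\<lambda>w. ?B (?A w))"
    using maps by (intro trace_on_diff[OF subspace_E_minus]) (auto intro!: D_mem)
  also have "trace_on (E_minus g) (\<lambda>w. ?A (?B w)) = trace_on (E_minus g) (\<lambda>w. ?B (?A w))"
    using maps linear_left[OF bilinear_D] linear_right[OF bilinear_D]
    by (intro trace_on_commute[OF subspace_E_minus S(1) S' subspace_E_minus S(1) S'])
  finally show ?thesis by (simp add: divergence_neg)
qed

end

text \<open>The chosen connection is known only to be Levi-Civita with divergence
  \<open>\<delta>\<close>. That suffices, since the two Ricci formulas hold for every such
  connection and reduce to the last two assumptions.\<close>

lemma generalized_einsteinI:
  assumes "\<And>x y z. P (M x y) z = 0" "\<And>x y z. M (P x y) z = 0"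
    and "\<And>x y. dual_apply \<delta> (pos (P x y)) = 0" "\<And>x y. dual_apply \<delta> (neg (M x y)) = 0"
  shows "generalized_einstein br H g \<delta>"
proof -
  let ?D = "levi_civita_choice br H g \<delta>"
  have "levi_civita br H g ?D" "divergence ?D = \<delta>"
    using someI_ex[OF levi_civita_with_divergence_exists] by (simp_all add: levi_civita_choice_def)
  then show ?thesis
    using ricci_plus_formula[of ?D] ricci_minus_formula[of ?D] assms three_form metric
    by (auto simp: generalized_einstein_def ricci_plus_def ricci_minus_def E_plus_eq E_minus_eq)
qed

end

section \<open>Three-dimensional unimodular Lie algebras\<close>

text \<open>A basis with its dual coordinate forms. The forms are parameters so that a given linear
  form can later serve as \<open>c3\<close>.\<close>

locale frame =
  fixes e1 e2 e3 :: "'a::real_vector" and c1 c2 c3 :: "'a \<Rightarrow> real"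
  assumes dim_3: "dim (UNIV :: 'a set) = 3"
    and linear_c: "linear c1" "linear c2" "linear c3"
    and c_e [simp]: "c1 e1 = 1" "c1 e2 = 0" "c1 e3 = 0" "c2 e1 = 0" "c2 e2 = 1" "c2 e3 = 0"
      "c3 e1 = 0" "c3 e2 = 0" "c3 e3 = 1"
    and expand: "x = c1 x *\<^sub>R e1 + c2 x *\<^sub>R e2 + c3 x *\<^sub>R e3"
begin

lemmas c_rules = linear_rules[OF linear_c(1)] linear_rules[OF linear_c(2)]
    linear_rules[OF linear_c(3)]

lemma frame_eqI: "c1 x = c1 y \<Longrightarrow> c2 x = c2 y \<Longrightarrow> c3 x = c3 y \<Longrightarrow> x = y"
  by (metis expand)

text \<open>\<open>f\<close> is a sum of three rank-one maps, whose traces do not refer to the basis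
  hidden in \<open>trace_on\<close>.\<close>

lemma trace_frame:
  assumes "linear f"
  shows "trace_on UNIV f = c1 (f e1) + c2 (f e2) + c3 (f e3)"
proof -
  have "x \<in> span {e1, e2, e3}" for x
    by (subst expand) (intro span_add span_scale span_base; simp)
  then have S: "finite {e1, e2, e3}" "UNIV \<subseteq> span {e1, e2, e3}" by auto
  have "f = (\<lambda>x. c1 x *\<^sub>R f e1 + c2 x *\<^sub>R f e2 + c3 x *\<^sub>R f e3)"
  proof
    fix x
    have "f x = f (c1 x *\<^sub>R e1 + c2 x *\<^sub>R e2 + c3 x *\<^sub>R e3)" using expand by metis
    then show "f x = c1 x *\<^sub>R f e1 + c2 x *\<^sub>R f e2 + c3 x *\<^sub>R f e3"
      by (simp add: linear_rules[OF assms])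
  qed
  then have "trace_on UNIV f = trace_on UNIV (\<lambda>x. c1 x *\<^sub>R f e1 + c2 x *\<^sub>R f e2 + c3 x *\<^sub>R f e3)"
    by (rule arg_cong)
  also have "\<dots> = c1 (f e1) + c2 (f e2) + c3 (f e3)"
    by (simp only: trace_on_add[OF subspace_UNIV subset_UNIV subset_UNIV]
        trace_on_rank_one[OF subspace_UNIV S linear_c(1) UNIV_I]
        trace_on_rank_one[OF subspace_UNIV S linear_c(2) UNIV_I]
        trace_on_rank_one[OF subspace_UNIV S linear_c(3) UNIV_I])
  finally show ?thesis .
qed

text \<open>The parameters are the upper triangle of the Gram matrix, row by row.\<close>

definition sym_form :: "real \<Rightarrow> real \<Rightarrow> real \<Rightarrow> real \<Rightarrow> real \<Rightarrow> real \<Rightarrow> 'a \<Rightarrow> 'a \<Rightarrow> real" where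
  "sym_form p q r s t u x y = p * (c1 x * c1 y) + q * (c1 x * c2 y + c2 x * c1 y)
    + r * (c1 x * c3 y + c3 x * c1 y) + s * (c2 x * c2 y) + t * (c2 x * c3 y + c3 x * c2 y)
    + u * (c3 x * c3 y)"

text \<open>\<open>?d\<close> is the determinant of the Gram matrix. By Cramer's rule,
  \<open>?d\<close> times each coordinate of a vector in the radical is a combination of the
  equations \<open>E\<close>.\<close>

lemma metric_sym_form:
  assumes "p * (s * u - t * t) - q * (q * u - r * t) + r * (q * t - r * s) \<noteq> 0" (is "?d \<noteq> 0")
  shows "metric_vector_space (sym_form p q r s t u)"
proof
  show "2 \<le> dim (UNIV :: 'a set)" by (simp add: dim_3)
  have "x = 0" if "\<forall>y. sym_form p q r s t u x y = 0" for x
  proof -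
    have E: "p * c1 x + q * c2 x + r * c3 x = 0" "q * c1 x + s * c2 x + t * c3 x = 0"
      "r * c1 x + t * c2 x + u * c3 x = 0"
      using that[rule_format, of e1] that[rule_format, of e2] that[rule_format, of e3]
      by (simp_all add: sym_form_def)
    have "?d * c1 x = 0" "?d * c2 x = 0" "?d * c3 x = 0"
      using E by algebra+
    then show ?thesis using assms by (intro frame_eqI) (simp_all add: c_rules)
  qed
  moreover have "bilinear (sym_form p q r s t u)"
    unfolding bilinear_def sym_form_def by (auto intro!: linearI simp: c_rules algebra_simps)
  ultimately show "nondegenerate_metric (sym_form p q r s t u)"
    unfolding nondegenerate_metric_def by (auto simp: sym_form_def algebra_simps)
qed

text \<open>The columns of the coefficient matrix are \<open>br e2 e3\<close>,
  \<open>br e3 e1\<close>, \<open>br e1 e2\<close>. The three trace conditions equate its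
  off-diagonal entries in pairs: unimodularity is symmetry of this matrix.\<close>

lemma bracket_coordinates:
  assumes "lie_algebra br" "unimodular br"
  obtains a b c d e f where
    "\<And>x y. c1 (br x y) = a * (c2 x * c3 y - c3 x * c2 y) + b * (c3 x * c1 y - c1 x * c3 y)
        + c * (c1 x * c2 y - c2 x * c1 y)"
    "\<And>x y. c2 (br x y) = b * (c2 x * c3 y - c3 x * c2 y) + d * (c3 x * c1 y - c1 x * c3 y)
        + e * (c1 x * c2 y - c2 x * c1 y)"
    "\<And>x y. c3 (br x y) = c * (c2 x * c3 y - c3 x * c2 y) + e * (c3 x * c1 y - c1 x * c3 y)
        + f * (c1 x * c2 y - c2 x * c1 y)"
proof -
  have bil: "bilinear br" and alt: "br x x = 0" for x
    using assms(1) by (auto simp: lie_algebra_def)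
  have skew: "br x y = - br y x" for x y
    using alt[of "x + y", unfolded bilinear_ladd[OF bil] bilinear_radd[OF bil]]
    by (simp add: alt eq_neg_iff_add_eq_0 add.commute)
  have "linear (br x)" for x
    using bil by (simp add: bilinear_def)
  then have tr: "c1 (br x e1) + c2 (br x e2) + c3 (br x e3) = 0" for x
    using assms(2) trace_frame by (metis unimodular_def)
  have sym: "c3 (br e3 e1) = c2 (br e1 e2)" "c3 (br e2 e3) = c1 (br e1 e2)"
      "c2 (br e2 e3) = c1 (br e3 e1)"
    using tr[of e1] tr[of e2] tr[of e3] skew[of e1 e3] skew[of e2 e1] skew[of e3 e2]
    by (simp_all add: alt c_rules)
  have br: "br x y = (c2 x * c3 y - c3 x * c2 y) *\<^sub>R br e2 e3 + (c3 x * c1 y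
      - c1 x * c3 y) *\<^sub>R br e3 e1
        + (c1 x * c2 y - c2 x * c1 y) *\<^sub>R br e1 e2" for x y
    by (subst expand[of x], subst expand[of y])
       (simp add: bilinear_rules[OF bil] alt skew[of e2 e1] skew[of e1 e3] skew[of e3 e2]
           algebra_simps)
  show ?thesis
    by (rule that[of "c1 (br e2 e3)" "c1 (br e3 e1)" "c1 (br e1 e2)" "c2 (br e3 e1)"
        "c2 (br e1 e2)" "c3 (br e1 e2)"];
        subst br; simp add: c_rules sym algebra_simps)
qed

end

section \<open>Frames, also with a prescribed coordinate form\<close>

lemma frame_of_basis:
  fixes e1 :: "'a::real_vector"
  assumes "dim (UNIV :: 'a set) = 3" "independent {e1, e2, e3}" "span {e1, e2, e3} = UNIV"
    "e1 \<noteq> e2" "e1 \<noteq> e3" "e2 \<noteq> e3"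
  obtains c1 c2 c3 where "frame e1 e2 e3 c1 c2 c3"
proof -
  let ?c = "\<lambda>e x. representation {e1, e2, e3} x e"
  have lin: "linear (?c e)" for e
    using assms by (intro linearI) (simp_all add: real_vector.representation_add
        real_vector.representation_scale)
  have expand: "x = ?c e1 x *\<^sub>R e1 + ?c e2 x *\<^sub>R e2 + ?c e3 x *\<^sub>R e3" for x
    using real_vector.sum_representation_eq[of "{e1, e2, e3}" x "{e1, e2, e3}"] assms
    by (simp add: add.assoc)
  have dual: "?c e1 e1 = 1" "?c e1 e2 = 0" "?c e1 e3 = 0" "?c e2 e1 = 0" "?c e2 e2 = 1"
      "?c e2 e3 = 0"
    "?c e3 e1 = 0" "?c e3 e2 = 0" "?c e3 e3 = 1"
    using assms by (simp_all add: real_vector.representation_basis)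
  have "frame e1 e2 e3 (?c e1) (?c e2) (?c e3)"
    by (rule frame.intro) (fact assms(1) lin dual expand)+
  then show ?thesis using that by blast
qed

lemma frame_exists:
  assumes "dim (UNIV :: 'a::real_vector set) = 3"
  obtains e1 e2 e3 :: "'a::real_vector" and c1 c2 c3 where "frame e1 e2 e3 c1 c2 c3"
proof -
  obtain B :: "'a set" where B: "independent B" "span B = UNIV" "card B = 3"
    using finite_basis_exists assms by (metis zero_less_numeral)
  then obtain e1 e2 e3 where "B = {e1, e2, e3}" "e1 \<noteq> e2" "e1 \<noteq> e3" "e2 \<noteq> e3"
    by (metis card_3_iff)
  then show ?thesis using frame_of_basis[OF assms] B that by metis
qed

text \<open>A basis of the kernel of \<open>\<alpha>\<close>, completed by a vector of value 1, has
  \<open>\<alpha>\<close> as its last coordinate form.\<close>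

lemma frame_adapted:
  fixes \<alpha> :: "'a::real_vector \<Rightarrow> real"
  assumes dim: "dim (UNIV :: 'a::real_vector set) = 3" and \<alpha>: "linear \<alpha>" "\<alpha> x0 \<noteq> 0"
  obtains e1 e2 e3 :: "'a::real_vector" and c1 c2 where "frame e1 e2 e3 c1 c2 \<alpha>"
proof -
  define w where "w = (1 / \<alpha> x0) *\<^sub>R x0"
  have w: "\<alpha> w = 1" using \<alpha> by (simp add: w_def linear_scale)
  let ?N = "{x. \<alpha> x = 0}"
  have N: "subspace ?N"
    using \<alpha>(1) by (simp add: linear_subspace_kernel)
  obtain K where K: "K \<subseteq> ?N" "independent K" "?N \<subseteq> span K"
    using real_vector.maximal_independent_subset by blast
  then have sK: "span K = ?N" using N by (metis span_minimal subset_antisym)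
  then have wK: "w \<notin> span K" using w by simp
  then have ind: "independent (insert w K)" using K(2) by (simp add: independent_insert)
  have "x \<in> span (insert w K)" for x
  proof -
    have "x - \<alpha> x *\<^sub>R w \<in> span K"
      using sK w by (simp add: linear_rules[OF \<alpha>(1)])
    then show ?thesis by (auto simp: span_insert)
  qed
  then have sp: "span (insert w K) = UNIV" by auto
  then have "card (insert w K) = 3"
    using ind dim real_vector.dim_span_eq_card_independent by metis
  moreover have "w \<notin> K" using wK span_base by blast
  moreover have "finite K"
    using calculation(1) by (metis card.infinite finite_insert zero_neq_numeral)
  ultimately have "card K = 2" by simp
  then obtain e1 e2 where e: "K = {e1, e2}" "e1 \<noteq> e2" by (metis card_2_iff)
  have wK_eq: "insert w K = {e1, e2, w}" using e by auto
  obtain c1 c2 c3 where F: "frame e1 e2 w c1 c2 c3"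
    by (rule frame_of_basis[OF dim, of e1 e2 w]) (use wK_eq ind sp e \<open>w \<notin> K\<close> in auto)
  interpret frame e1 e2 w c1 c2 c3 by (fact F)
  have "\<alpha> e1 = 0" "\<alpha> e2 = 0" using e K(1) by auto
  have "\<alpha> x = c3 x" for x
  proof -
    have "\<alpha> x = \<alpha> (c1 x *\<^sub>R e1 + c2 x *\<^sub>R e2 + c3 x *\<^sub>R w)" using expand by metis
    then show ?thesis using \<open>\<alpha> e1 = 0\<close> \<open>\<alpha> e2 = 0\<close> w by (simp add: linear_rules[OF \<alpha>(1)])
  qed
  then have "\<alpha> = c3" by auto
  then show ?thesis using F that by blast
qed

text \<open>Skewness of \<open>B\<close> is metricity of \<open>?P\<close>, and \<open>br\<close> is
  absence of torsion. By \<open>B0\<close>, \<open>\<alpha>\<close> vanishes on every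
  \<open>?P x y\<close>; hence \<open>?P (?P x y) z = 0\<close>, and
  \<open>\<alpha> \<circ> fst\<close> is an admissible divergence.\<close>

lemma einstein_if_flat:
  fixes br :: "'a::real_vector \<Rightarrow> 'a \<Rightarrow> 'a"
  assumes g: "metric_vector_space g" and \<alpha>: "linear \<alpha>" "\<alpha> x0 \<noteq> 0" and B: "linear B"
    and skew: "\<And>x y. g (B x) y = - g (B y) x" and B0: "\<And>x. \<alpha> (B x) = 0"
    and br: "\<And>x y. br x y = \<alpha> x *\<^sub>R B y - \<alpha> y *\<^sub>R B x"
  shows "\<exists>H g \<delta>. \<delta> \<noteq> 0 \<and> generalized_einstein br H g \<delta> \<and> generalized_einstein br H g 0"
proof -
  interpret metric_vector_space g by (fact g)
  let ?P = "\<lambda>x y. \<alpha> x *\<^sub>R B y"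
  have P: "bilinear ?P"
    unfolding bilinear_def
    by (auto intro!: linearI simp: linear_rules[OF \<alpha>(1)] linear_rules[OF B] algebra_simps)
  interpret mixed_bracket g br "\<lambda>_ _ _. 0" ?P ?P
  proof
    show "g (?P x y) z = - g (?P x z) y" for x y z
      using skew[of y z] by (simp add: bilinear_rules[OF bilinear_g])
  qed (use P in \<open>simp_all add: br three_form_def linear_iff\<close>)
  have lin: "linear (\<lambda>u :: 'a gen. \<alpha> (fst u))"
    using linear_compose[OF linear_fst \<alpha>(1)] by (simp add: o_def)
  define \<delta> :: "'a gen dual_space" where "\<delta> = Dual (\<lambda>u. \<alpha> (fst u))"
  have \<delta>: "dual_apply \<delta> u = \<alpha> (fst u)" for u
    by (simp add: \<delta>_def dual_apply_Dual[OF lin])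
  have "dual_apply \<delta> (x0, 0) \<noteq> dual_apply 0 (x0, 0)"
    by (simp add: \<delta> dual_apply_simps \<alpha>)
  then have "\<delta> \<noteq> 0" by metis
  moreover have "generalized_einstein br (\<lambda>_ _ _. 0) g \<delta>" "generalized_einstein br (\<lambda>_ _ _. 0) g 0"
    by (rule generalized_einsteinI;
        simp add: \<delta> dual_apply_simps pos_def neg_def B0 linear_rules[OF \<alpha>(1)] linear_rules[OF B])+
  ultimately show ?thesis by blast
qed

text \<open>Invariance of \<open>g\<close> makes \<open>H\<close> the Cartan three-form. With
  \<open>P = br\<close> and \<open>M = 0\<close> all mixed composites vanish.\<close>

lemma einstein_if_invariant_metric:
  fixes br :: "'a::real_vector \<Rightarrow> 'a \<Rightarrow> 'a"
  assumes g: "metric_vector_space g" and br: "bilinear br" "\<And>x. br x x = 0"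
    and inv: "\<And>x y z. g (br x y) z = - g (br x z) y"
  shows "\<exists>H g \<delta>. \<delta> \<noteq> 0 \<and> generalized_einstein br H g \<delta> \<and> generalized_einstein br H g 0"
proof -
  interpret metric_vector_space g by (fact g)
  define H where "H x y z = g (br x y) z" for x y z
  have "three_form H"
    unfolding three_form_def
  proof (intro conjI allI)
    show "linear (\<lambda>x. H x y z)" "linear (\<lambda>x. H y x z)" "linear (\<lambda>x. H y z x)" for y z
      by (auto intro!: linearI simp: H_def bilinear_rules[OF br(1)] bilinear_rules[OF bilinear_g])
    show "H x x y = 0" for x y
      by (simp add: H_def br(2) bilinear_rules[OF bilinear_g])
    show "H y x x = 0" for x y
      using inv[of y x x] by (simp add: H_def)
    show "H x y x = 0" for x y
      using inv[of x y x] by (simp add: H_def br(2) bilinear_rules[OF bilinear_g])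
  qed
  interpret mixed_bracket g br H br "\<lambda>_ _. 0"
  proof
    show "bilinear br" by fact
    show "three_form H" by fact
    show "g (br x y) z = - g (br x z) y" for x y z by (rule inv)
  qed (simp_all add: H_def bilinear_def linear_iff bilinear_rules[OF bilinear_g])
  obtain B :: "'a set" where B: "independent B" "card B \<ge> 2"
    using finite_basis_exists dim_ge_2 by (metis less_le_trans pos2)
  then obtain v where "v \<in> B"
    by fastforce
  then have "v \<noteq> 0"
    using B(1) real_vector.dependent_zero by blast
  then obtain z where z: "g v z \<noteq> 0"
    using g_eqI[of v 0] by (auto simp: bilinear_rules[OF bilinear_g])
  \<comment> \<open>This functional vanishes on \<open>E_plus g\<close>, hence on all
    \<open>pos (br x y)\<close>; the condition on \<open>E_minus g\<close> is trivial because
    \<open>M = 0\<close>.\<close>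
  define \<delta> :: "'a gen dual_space" where "\<delta> = Dual (\<lambda>u. g v (neg_part u))"
  have \<delta>: "dual_apply \<delta> u = g v (neg_part u)" for u
    using linear_compose[OF linear_neg_part linear_g] by (simp add: \<delta>_def dual_apply_Dual o_def)
  have "dual_apply \<delta> (neg z) \<noteq> dual_apply 0 (neg z)"
    by (simp add: \<delta> dual_apply_simps z)
  then have "\<delta> \<noteq> 0" by metis
  moreover have "generalized_einstein br H g \<delta>" "generalized_einstein br H g 0"
    by (rule generalized_einsteinI;
        simp add: \<delta> dual_apply_simps split_rules bilinear_rules[OF br(1)]
            bilinear_rules[OF bilinear_g])+
  ultimately show ?thesis by blast
qed

text \<open>A nonzero cofactor column is a kernel vector; if all cofactors vanish the rank is at most one.\<close>

lemma symmetric_kernel: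
  fixes a b c d e f :: real
  assumes "a * (d * f - e * e) - b * (b * f - c * e) + c * (b * e - c * d) = 0"
  obtains v1 v2 v3 where "v1 \<noteq> 0 \<or> v2 \<noteq> 0 \<or> v3 \<noteq> 0" "a * v1 + b * v2 + c * v3 = 0"
    "b * v1 + d * v2 + e * v3 = 0" "c * v1 + e * v2 + f * v3 = 0"
proof -
  define k1 k2 k3 k4 k5 k6 where k: "k1 = d * f - e * e" "k2 = c * e - b * f" "k3 = b * e - c * d"
    "k4 = a * f - c * c" "k5 = b * c - a * e" "k6 = a * d - b * b"
  consider "k1 \<noteq> 0 \<or> k2 \<noteq> 0 \<or> k3 \<noteq> 0" | "k2 \<noteq> 0 \<or> k4 \<noteq> 0 \<or> k5 \<noteq> 0" | "k3 \<noteq> 0 \<or> k5 \<noteq> 0 \<or> k6 \<noteq> 0"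
    | "k1 = 0" "k2 = 0" "k3 = 0" "k4 = 0" "k5 = 0" "k6 = 0" by blast
  then show ?thesis
  proof cases
    case 1
    then show ?thesis by (rule that) (use assms in \<open>simp_all add: k algebra_simps\<close>)
  next
    case 2
    then show ?thesis by (rule that) (use assms in \<open>simp_all add: k algebra_simps\<close>)
  next
    case 3
    then show ?thesis by (rule that) (use assms in \<open>simp_all add: k algebra_simps\<close>)
  next
    case 4
    \<comment> \<open>The matrix sends the first two candidates to vectors whose entries are 0 or 2
      by 2 minors up to sign. If the first row vanishes, so does the first column, by
      symmetry.\<close>
    consider "a \<noteq> 0 \<or> b \<noteq> 0" | "a = 0" "b = 0" "c \<noteq> 0" | "a = 0" "b = 0" "c = 0" by blast
    then show ?thesis
    proof cases
      case 1
      then show ?thesis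
        by (intro that[of b "-a" 0]) (use 4 in \<open>auto simp: k algebra_simps\<close>)
    next
      case 2
      then show ?thesis
        by (intro that[of c 0 "-a"]) (use 4 in \<open>auto simp: k algebra_simps\<close>)
    next
      case 3
      then show ?thesis by (intro that[of 1 0 0]) simp_all
    qed
  qed
qed

section \<open>Nonsingular and singular structure matrices\<close>

context frame
begin

text \<open>With L the structure matrix and \<open>?g\<close> its adjugate,
  \<open>?g (br x y) z\<close> is det L times the triple product of \<open>x\<close>,
  \<open>y\<close>, \<open>z\<close>, which is totally skew.\<close>

lemma einstein_if_nonsingular:
  assumes lie: "lie_algebra br"
    and br: "\<And>x y. c1 (br x y) = a * (c2 x * c3 y - c3 x * c2 y) + b * (c3 x * c1 y - c1 x * c3 y)
        + c * (c1 x * c2 y - c2 x * c1 y)"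
    "\<And>x y. c2 (br x y) = b * (c2 x * c3 y - c3 x * c2 y) + d * (c3 x * c1 y - c1 x * c3 y)
        + e * (c1 x * c2 y - c2 x * c1 y)"
    "\<And>x y. c3 (br x y) = c * (c2 x * c3 y - c3 x * c2 y) + e * (c3 x * c1 y - c1 x * c3 y)
        + f * (c1 x * c2 y - c2 x * c1 y)"
    and det: "a * (d * f - e * e) - b * (b * f - c * e) + c * (b * e - c * d) \<noteq> 0" (is "?d \<noteq> 0")
  shows "\<exists>H g \<delta>. \<delta> \<noteq> 0 \<and> generalized_einstein br H g \<delta> \<and> generalized_einstein br H g 0"
proof (rule einstein_if_invariant_metric)
  let ?g = "sym_form (d * f - e * e) (c * e - b * f) (b * e - c * d) (a * f - c * c) (b * c
      - a * e) (a * d - b * b)"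
  show "metric_vector_space ?g"
  proof (rule metric_sym_form)
    \<comment> \<open>The determinant of the adjugate of a 3 by 3 matrix is the square of its
      determinant.\<close>
    have "(d * f - e * e) * ((a * f - c * c) * (a * d - b * b) - (b * c - a * e) * (b * c - a * e))
      - (c * e - b * f) * ((c * e - b * f) * (a * d - b * b) - (b * e - c * d) * (b * c - a * e))
      + (b * e - c * d) * ((c * e - b * f) * (b * c - a * e) - (b * e - c * d) * (a * f - c * c))
          = ?d * ?d"
      by algebra
    then show "(d * f - e * e) * ((a * f - c * c) * (a * d - b * b) - (b * c - a * e) * (b * c
        - a * e))
      - (c * e - b * f) * ((c * e - b * f) * (a * d - b * b) - (b * e - c * d) * (b * c - a * e))
      + (b * e - c * d) * ((c * e - b * f) * (b * c - a * e) - (b * e - c * d) * (a * f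
          - c * c)) \<noteq> 0"
      using det by simp
  qed
  show "bilinear br" "br x x = 0" for x
    using lie by (simp_all add: lie_algebra_def)
  show "?g (br x y) z = - ?g (br x z) y" for x y z
    unfolding sym_form_def br by algebra
qed

text \<open>Here \<open>e1\<close> and \<open>e2\<close> commute, so the bracket has the shape
  required by \<open>einstein_if_flat\<close> with \<open>B = br e3\<close>. Adding to
  \<open>B\<close> a multiple \<open>c3 x\<close> of a fixed vector does not change the bracket;
  this freedom makes \<open>B\<close> skew when the block with entries \<open>a\<close>,
  \<open>b\<close>, \<open>d\<close> has rank one. The cases follow that rank.\<close>

lemma einstein_if_singular:
  assumes lie: "lie_algebra br"
    and br: "\<And>x y. c1 (br x y) = a * (c2 x * c3 y - c3 x * c2 y) + b * (c3 x * c1 y - c1 x * c3 y)"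
    "\<And>x y. c2 (br x y) = b * (c2 x * c3 y - c3 x * c2 y) + d * (c3 x * c1 y - c1 x * c3 y)"
    "\<And>x y. c3 (br x y) = 0"
  shows "\<exists>H g \<delta>. \<delta> \<noteq> 0 \<and> generalized_einstein br H g \<delta> \<and> generalized_einstein br H g 0"
proof -
  have c3: "c3 e3 \<noteq> 0" by simp
  consider "a * d - b * b \<noteq> 0" | "a * d = b * b" "a \<noteq> 0" | "a = 0" "b = 0" "d \<noteq> 0" | "a = 0"
      "b = 0" "d = 0"
    by fastforce
  then show ?thesis
  proof cases
    case 1
    \<comment> \<open>the nondegenerate form on \<open>span {e1, e2}\<close> that is invariant under \<open>ad e3\<close>\<close>
    have g: "metric_vector_space (sym_form d (- b) 0 a 0 1)"
      using 1 by (intro metric_sym_form) (simp add: algebra_simps)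
    have "linear (br e3)"
      using lie by (simp add: lie_algebra_def bilinear_def)
    then show ?thesis
      by (rule einstein_if_flat[OF g linear_c(3) c3])
         (auto intro!: frame_eqI simp: sym_form_def br c_rules algebra_simps)
  next
    case 2
    \<comment> \<open>Heisenberg algebra with centre spanned by \<open>a e1 + b e2\<close>; the metric is Lorentzian with null
      centre, which makes it flat\<close>
    let ?k = "b / a"
    have g: "metric_vector_space (sym_form (?k * ?k) (- ?k) (1 / a) 1 0 0)"
      using 2 by (intro metric_sym_form) simp
    \<comment> \<open>The first summand is \<open>br e3 x\<close>; the second cancels in the bracket
      and makes \<open>B\<close> skew.\<close>
    define B where "B x = (?k * c1 x - c2 x) *\<^sub>R (a *\<^sub>R e1 + b *\<^sub>R e2) + c3 x *\<^sub>R e2" for x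
    have "linear B"
      by (auto intro!: linearI simp: B_def c_rules algebra_simps)
    have ad: "a * (d * z) = b * (b * z)" for z
      using 2(1) by (metis mult.assoc)
    show ?thesis
      using 2(2) \<open>linear B\<close> by (intro einstein_if_flat[OF g linear_c(3) c3, of B])
         (auto intro!: frame_eqI simp: sym_form_def B_def br c_rules ad field_simps)
  next
    case 3
    \<comment> \<open>Heisenberg algebra again, with centre spanned by the null vector
      \<open>e2\<close>.\<close>
    have g: "metric_vector_space (sym_form 1 0 0 0 (1 / d) 0)"
      using 3 by (intro metric_sym_form) simp
    define B where "B x = (d * c1 x) *\<^sub>R e2 - c3 x *\<^sub>R e1" for x
    have "linear B"
      by (auto intro!: linearI simp: B_def c_rules algebra_simps)
    then show ?thesis
      using 3 by (intro einstein_if_flat[OF g linear_c(3) c3, of B])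
         (auto intro!: frame_eqI simp: sym_form_def B_def br c_rules field_simps)
  next
    case 4
    have g: "metric_vector_space (sym_form 1 0 0 1 0 1)"
      by (intro metric_sym_form) simp
    show ?thesis
      using 4 by (intro einstein_if_flat[OF g linear_c(3) c3, of "\<lambda>_. 0"])
         (auto intro!: frame_eqI simp: sym_form_def br c_rules linear_iff)
  qed
qed

end

theorem theorem1p4:
  fixes br :: "'a::real_vector \<Rightarrow> 'a \<Rightarrow> 'a"
  assumes "lie_algebra br"
    and "dim (UNIV :: 'a set) = 3"
    and "unimodular br"
  shows "(\<exists>H g \<delta>. generalized_einstein br H g \<delta> \<and> \<delta> \<noteq> 0) \<and>
         (\<exists>H' g'. generalized_einstein br H' g' 0)"
proof -
  obtain e1 e2 e3 :: 'a and c1 c2 c3 where F: "frame e1 e2 e3 c1 c2 c3"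
    using frame_exists[OF assms(2)] by blast
  interpret F: frame e1 e2 e3 c1 c2 c3 by (fact F)
  obtain a b c d e f where br:
    "\<And>x y. c1 (br x y) = a * (c2 x * c3 y - c3 x * c2 y) + b * (c3 x * c1 y - c1 x * c3 y)
        + c * (c1 x * c2 y - c2 x * c1 y)"
    "\<And>x y. c2 (br x y) = b * (c2 x * c3 y - c3 x * c2 y) + d * (c3 x * c1 y - c1 x * c3 y)
        + e * (c1 x * c2 y - c2 x * c1 y)"
    "\<And>x y. c3 (br x y) = c * (c2 x * c3 y - c3 x * c2 y) + e * (c3 x * c1 y - c1 x * c3 y)
        + f * (c1 x * c2 y - c2 x * c1 y)"
    using F.bracket_coordinates[OF assms(1,3)] by blast
  have "\<exists>H g \<delta>. \<delta> \<noteq> 0 \<and> generalized_einstein br H g \<delta> \<and> generalized_einstein br H g 0"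
  proof (cases "a * (d * f - e * e) - b * (b * f - c * e) + c * (b * e - c * d) = 0")
    case False
    then show ?thesis using F.einstein_if_nonsingular[OF assms(1) br] by blast
  next
    case True
    then obtain v1 v2 v3 where v: "v1 \<noteq> 0 \<or> v2 \<noteq> 0 \<or> v3 \<noteq> 0" "a * v1 + b * v2 + c * v3 = 0"
      "b * v1 + d * v2 + e * v3 = 0" "c * v1 + e * v2 + f * v3 = 0"
      by (rule symmetric_kernel)
    \<comment> \<open>A kernel vector of the symmetric structure matrix, read as a linear form,
      annihilates the image of that matrix and thus all brackets.\<close>
    define \<alpha> where "\<alpha> x = v1 * c1 x + v2 * c2 x + v3 * c3 x" for x
    have lin: "linear \<alpha>"
      by (auto intro!: linearI simp: \<alpha>_def F.c_rules algebra_simps)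
    have "\<alpha> (br x y) = (a * v1 + b * v2 + c * v3) * (c2 x * c3 y - c3 x * c2 y)
      + (b * v1 + d * v2 + e * v3) * (c3 x * c1 y - c1 x * c3 y)
      + (c * v1 + e * v2 + f * v3) * (c1 x * c2 y - c2 x * c1 y)" for x y
      unfolding \<alpha>_def br by algebra
    then have \<alpha>_br: "\<alpha> (br x y) = 0" for x y
      using v by simp
    \<comment> \<open>Evaluating \<open>\<alpha>\<close> at its own coefficient vector gives a sum
      of squares, which shows \<open>\<alpha> \<noteq> 0\<close>.\<close>
    have "\<alpha> (v1 *\<^sub>R e1 + v2 *\<^sub>R e2 + v3 *\<^sub>R e3) = v1 * v1 + v2 * v2 + v3 * v3"
      by (simp add: \<alpha>_def F.c_rules)
    also have "\<dots> \<noteq> 0"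
      using v(1) sum_power2_eq_zero_iff[of v1 v2]
      by (smt (verit) not_sum_squares_lt_zero sum_squares_eq_zero_iff zero_le_square)
    finally obtain w1 w2 w3 :: 'a and k1 k2 where G: "frame w1 w2 w3 k1 k2 \<alpha>"
      using frame_adapted[OF assms(2) lin] by blast
    interpret G: frame w1 w2 w3 k1 k2 \<alpha> by (fact G)
    \<comment> \<open>In the adapted frame the structure matrix is again symmetric, so its vanishing
      third row also removes the third column.\<close>
    obtain a b c d e f where br:
      "\<And>x y. k1 (br x y) = a * (k2 x * \<alpha> y - \<alpha> x * k2 y) + b * (\<alpha> x * k1 y - k1 x * \<alpha> y)
          + c * (k1 x * k2 y - k2 x * k1 y)"
      "\<And>x y. k2 (br x y) = b * (k2 x * \<alpha> y - \<alpha> x * k2 y) + d * (\<alpha> x * k1 y - k1 x * \<alpha> y)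
          + e * (k1 x * k2 y - k2 x * k1 y)"
      "\<And>x y. \<alpha> (br x y) = c * (k2 x * \<alpha> y - \<alpha> x * k2 y) + e * (\<alpha> x * k1 y - k1 x * \<alpha> y)
          + f * (k1 x * k2 y - k2 x * k1 y)"
      using G.bracket_coordinates[OF assms(1,3)] by blast
    have "c = 0" "e = 0"
      using br(3)[of w2 w3] br(3)[of w3 w1] by (simp_all add: \<alpha>_br)
    then show ?thesis
      using br \<alpha>_br by (intro G.einstein_if_singular[OF assms(1), of a b d]) simp_all
  qed
  then show ?thesis by blast
qed

end
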